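(* Let $\varphi_\tau,\tilde\varphi_\tau\in H$ and $f,\tilde f\in L^1([0,\tau],H)$ satisfy $$\|\varphi_\tau-\tilde\varphi_\tau\|+\|f-\tilde f\|_1\le\delta$$ for some $\delta>0$. Then for every $t\in[0,\tau]$ and $\beta>0$, $$\|u_\beta(t)-\tilde u_\beta(t)\|\le e^{(\tau-t)\beta}\delta .$$ Suppose moreover that $\psi(t)\in D(e^{\tau A})$ for each $t\in[0,\tau)$, that $t\in[0,\tau)$, that $h_t:[0,\infty)\to(0,\infty)$ is a monotonically increasing continuous function with $h_t(\lambda)\to\infty$ as $\lambda\to\infty$ and $u(t)\in D(h_t(A))$, and that $\rho_t>0$ is such that $\|h_t(A)u(t)\|\le\rho_t$. Then there are numbers $\rho_{t,\beta}\ge0$ $(\beta>0)$, not depending on $\delta$, $\tilde\varphi_\tau$, $\tilde f$, with $\rho_{t,\beta}\le\rho_t$ for all $\beta>0$ and $\rho_{t,\beta}\to0$ as $\beta\to\infty$, such that for every $\beta>0$, $$\|u(t)-u_\beta(t)\|\le\frac{\rho_{t,\beta}}{h_t(\beta)}\qquad\text{and}\qquad \|u(t)-\tilde u_\beta(t)\|\le\frac{\rho_{t,\beta}}{h_t(\beta)}+e^{(\tau-t)\beta}\delta .$$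
   Context: $H$ is a Hilbert space and $A:D(A)\subseteq H\to H$ is a densely defined positive self-adjoint (possibly unbounded) operator, with spectrum contained in $[0,\infty)$ and spectral resolution $\{E_\lambda\}$. For a continuous $g:[0,\infty)\to\mathbb{R}$, $g(A)\varphi=\int_0^\infty g(\lambda)\,dE_\lambda\varphi$ on $D(g(A))=\{\varphi\in H:\int_0^\infty |g(\lambda)|^2\,d\|E_\lambda\varphi\|^2<\infty\}$; in particular this defines $e^{rA}$ for every $r\in\mathbb{R}$. Fix $\tau>0$. Set $$\psi(t):=\varphi_\tau-\int_t^\tau e^{-(\tau-s)A}f(s)\,ds,\qquad \tilde\psi(t):=\tilde\varphi_\tau-\int_t^\tau e^{-(\tau-s)A}\tilde f(s)\,ds .$$ The mild solution of the final value problem $u'(t)+Au(t)=f(t)$ $(0\le t<\tau)$, $u(\tau)=\varphi_\tau$, is $u(t)=e^{(\tau-t)A}\psi(t)$, defined when $\psi(t)\in D(e^{(\tau-t)A})$. For $\beta>0$, $$u_\beta(t)=\int_0^\beta e^{(\tau-t)\lambda}\,dE_\lambda(\psi(t)),\qquad \tilde u_\beta(t)=\int_0^\beta e^{(\tau-t)\lambda}\,dE_\lambda(\tilde\psi(t)),$$ the integrals being over $[0,\beta]$. $\|\cdot\|_1$ is the norm of $L^1([0,\tau],H)$. *)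

theory Defs
  imports "HOL-Analysis.Analysis"
begin

text \<open>
  A Hilbert space is a type of class \<open>{real_inner, banach}\<close>.  Real scalars include the complex
  case: a complex Hilbert space with inner product \<open>Re \<langle>x, y\<rangle>\<close> is such a type, the norm is
  unchanged, a positive self-adjoint complex operator is positive self-adjoint for \<open>Re \<langle>x, y\<rangle>\<close>,
  and it has the same spectral resolution.  Separability is not assumed.

  An unbounded operator is a set \<open>D\<close> (its domain) together with a total function \<open>A\<close> whose
  values outside \<open>D\<close> are irrelevant.
\<close>

section \<open>Unbounded operators\<close>

definition linear_operator :: "'h::real_vector set \<Rightarrow> ('h \<Rightarrow> 'h) \<Rightarrow> bool" where
  "linear_operator D A \<longleftrightarrow>
     subspace D \<and>
     (\<forall>x\<in>D. \<forall>y\<in>D. A (x + y) = A x + A y) \<and>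
     (\<forall>c. \<forall>x\<in>D. A (c *\<^sub>R x) = c *\<^sub>R A x)"

text \<open>The graph of the adjoint; it is the graph of a function exactly when \<open>D\<close> is dense.\<close>

definition adjoint_graph :: "'h::real_inner set \<Rightarrow> ('h \<Rightarrow> 'h) \<Rightarrow> ('h \<times> 'h) set" where
  "adjoint_graph D A = {(y, z). \<forall>x\<in>D. A x \<bullet> y = x \<bullet> z}"

definition self_adjoint_operator :: "'h::real_inner set \<Rightarrow> ('h \<Rightarrow> 'h) \<Rightarrow> bool" where
  "self_adjoint_operator D A \<longleftrightarrow>
     linear_operator D A \<and> closure D = UNIV \<and> adjoint_graph D A = {(y, A y) | y. y \<in> D}"

definition positive_operator :: "'h::real_inner set \<Rightarrow> ('h \<Rightarrow> 'h) \<Rightarrow> bool" where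
  "positive_operator D A \<longleftrightarrow> (\<forall>x\<in>D. 0 \<le> A x \<bullet> x)"

section \<open>Spectral families and integrals\<close>

definition orthogonal_projection :: "('h::real_inner \<Rightarrow> 'h) \<Rightarrow> bool" where
  "orthogonal_projection P \<longleftrightarrow>
     bounded_linear P \<and> (\<forall>x. P (P x) = P x) \<and> (\<forall>x y. P x \<bullet> y = x \<bullet> P y)"

definition spectral_family :: "(real \<Rightarrow> 'h::real_inner \<Rightarrow> 'h) \<Rightarrow> bool" where
  "spectral_family E \<longleftrightarrow>
     (\<forall>l. orthogonal_projection (E l)) \<and>
     (\<forall>l m x. E l (E m x) = E (min l m) x) \<and>
     (\<forall>l x. ((\<lambda>m. E m x) \<longlongrightarrow> E l x) (at_right l)) \<and>
     (\<forall>x. ((\<lambda>l. E l x) \<longlongrightarrow> 0) at_bot) \<and>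
     (\<forall>x. ((\<lambda>l. E l x) \<longlongrightarrow> x) at_top)"

text \<open>The measure \<open>d\<parallel>E\<^sub>\<lambda> x\<parallel>\<^sup>2\<close>.\<close>

definition spectral_measure :: "(real \<Rightarrow> 'h::real_inner \<Rightarrow> 'h) \<Rightarrow> 'h \<Rightarrow> real measure" where
  "spectral_measure E x = interval_measure (\<lambda>l. (norm (E l x))\<^sup>2)"

text \<open>
  The vector \<open>\<integral>\<^sub>S g(\<lambda>) dE\<^sub>\<lambda> x\<close> is the extension by continuity (with respect to
  \<open>L\<^sup>2(d\<parallel>E\<^sub>\<lambda> x\<parallel>\<^sup>2)\<close>) of the evident integral of step functions.  A triple \<open>(c, a, b)\<close>
  stands for \<open>c\<close> times the indicator of \<open>(a, b]\<close>.
  Taking \<open>S = {0..\<beta>}\<close> or \<open>S = {0..}\<close> includes a possible atom \<open>E\<^sub>0 x\<close> at \<open>0\<close>.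
\<close>

definition step_fun :: "(real \<times> real \<times> real) list \<Rightarrow> real \<Rightarrow> real" where
  "step_fun ps l = (\<Sum>(c, a, b)\<leftarrow>ps. c * indicator {a<..b} l)"

definition step_integral ::
  "(real \<Rightarrow> 'h::real_inner \<Rightarrow> 'h) \<Rightarrow> (real \<times> real \<times> real) list \<Rightarrow> 'h \<Rightarrow> 'h" where
  "step_integral E ps x = (\<Sum>(c, a, b)\<leftarrow>ps. c *\<^sub>R (E b x - E a x))"

definition has_spectral_integral ::
  "(real \<Rightarrow> 'h::real_inner \<Rightarrow> 'h) \<Rightarrow> real set \<Rightarrow> (real \<Rightarrow> real) \<Rightarrow> 'h \<Rightarrow> 'h \<Rightarrow> bool" where
  "has_spectral_integral E S g x y \<longleftrightarrow>
     set_borel_measurable borel S g \<and>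
     (\<exists>ps :: nat \<Rightarrow> (real \<times> real \<times> real) list.
        (\<forall>n. \<forall>(c, a, b)\<in>set (ps n). a \<le> b) \<and>
        (\<lambda>n. \<integral>\<^sup>+l. ennreal ((indicator S l * g l - step_fun (ps n) l)\<^sup>2) \<partial>spectral_measure E x)
          \<longlonglongrightarrow> 0 \<and>
        (\<lambda>n. step_integral E (ps n) x) \<longlonglongrightarrow> y)"

definition spectral_integral ::
  "(real \<Rightarrow> 'h::real_inner \<Rightarrow> 'h) \<Rightarrow> real set \<Rightarrow> (real \<Rightarrow> real) \<Rightarrow> 'h \<Rightarrow> 'h" where
  "spectral_integral E S g x = (THE y. has_spectral_integral E S g x y)"

definition spectral_resolution ::
  "'h::real_inner set \<Rightarrow> ('h \<Rightarrow> 'h) \<Rightarrow> (real \<Rightarrow> 'h \<Rightarrow> 'h) \<Rightarrow> bool" where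
  "spectral_resolution D A E \<longleftrightarrow>
     spectral_family E \<and>
     D = {x. integrable (spectral_measure E x) (\<lambda>l. l\<^sup>2)} \<and>
     (\<forall>x\<in>D. has_spectral_integral E UNIV (\<lambda>l. l) x (A x))"

text \<open>
  The domain and the values of \<open>g(A)\<close> for \<open>g\<close> continuous on \<open>[0, \<infinity>)\<close>, where \<open>E\<close> is the spectral
  resolution of \<open>A\<close>.
\<close>

definition fun_dom ::
  "(real \<Rightarrow> 'h::real_inner \<Rightarrow> 'h) \<Rightarrow> (real \<Rightarrow> real) \<Rightarrow> 'h set" where
  "fun_dom E g = {x. set_integrable (spectral_measure E x) {0..} (\<lambda>l. \<bar>g l\<bar>\<^sup>2)}"

definition fun_op ::
  "(real \<Rightarrow> 'h::real_inner \<Rightarrow> 'h) \<Rightarrow> (real \<Rightarrow> real) \<Rightarrow> 'h \<Rightarrow> 'h" where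
  "fun_op E g x = spectral_integral E {0..} g x"

section \<open>Bochner integrals without separability\<close>

text \<open>
  The library's \<^const>\<open>has_bochner_integral\<close>, with the same defining conditions, but without the
  sort constraint \<open>second_countable_topology\<close>, which would restrict to separable spaces.
\<close>

definition has_bochner ::
  "'a measure \<Rightarrow> ('a \<Rightarrow> 'b::real_normed_vector) \<Rightarrow> 'b \<Rightarrow> bool" where
  "has_bochner M f y \<longleftrightarrow>
     f \<in> borel_measurable M \<and>
     (\<exists>s. (\<forall>i. Bochner_Integration.simple_bochner_integrable M (s i)) \<and>
          (\<lambda>i. \<integral>\<^sup>+x. ennreal (norm (f x - s i x)) \<partial>M) \<longlonglongrightarrow> 0 \<and>
          (\<lambda>i. Bochner_Integration.simple_bochner_integral M (s i)) \<longlonglongrightarrow> y)"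

definition bochner :: "'a measure \<Rightarrow> ('a \<Rightarrow> 'b::real_normed_vector) \<Rightarrow> 'b" where
  "bochner M f = (THE y. has_bochner M f y)"

definition L1 :: "real \<Rightarrow> (real \<Rightarrow> 'b::real_normed_vector) set" where
  "L1 \<tau> = {f. \<exists>y. has_bochner (lebesgue_on {0..\<tau>}) f y}"

definition L1_norm :: "real \<Rightarrow> (real \<Rightarrow> 'b::real_normed_vector) \<Rightarrow> real" where
  "L1_norm \<tau> f = (LINT s|lebesgue_on {0..\<tau>}. norm (f s))"

section \<open>The final value problem\<close>

definition psi ::
  "(real \<Rightarrow> 'h::real_inner \<Rightarrow> 'h) \<Rightarrow> real \<Rightarrow> 'h \<Rightarrow> (real \<Rightarrow> 'h) \<Rightarrow> real \<Rightarrow> 'h" where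
  "psi E \<tau> \<phi> f t =
     \<phi> - bochner (lebesgue_on {t..\<tau>}) (\<lambda>s. fun_op E (\<lambda>l. exp (- (\<tau> - s) * l)) (f s))"

definition mild_solution ::
  "(real \<Rightarrow> 'h::real_inner \<Rightarrow> 'h) \<Rightarrow> real \<Rightarrow> 'h \<Rightarrow> (real \<Rightarrow> 'h) \<Rightarrow> real \<Rightarrow> 'h" where
  "mild_solution E \<tau> \<phi> f t = fun_op E (\<lambda>l. exp ((\<tau> - t) * l)) (psi E \<tau> \<phi> f t)"

definition truncated_solution ::
  "(real \<Rightarrow> 'h::real_inner \<Rightarrow> 'h) \<Rightarrow> real \<Rightarrow> 'h \<Rightarrow> (real \<Rightarrow> 'h) \<Rightarrow> real \<Rightarrow> real \<Rightarrow> 'h" where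
  "truncated_solution E \<tau> \<phi> f \<beta> t =
     spectral_integral E {0..\<beta>} (\<lambda>l. exp ((\<tau> - t) * l)) (psi E \<tau> \<phi> f t)"

end

theory Submission
  imports Defs "HOL-Probability.Distribution_Functions"
begin

text \<open>
  Everything rests on the isometry \<open>\<parallel>\<integral>g dE x\<parallel>\<^sup>2 = \<integral>\<bar>g\<bar>\<^sup>2 d\<parallel>E x\<parallel>\<^sup>2\<close>, extended from step functions by
  continuity.  It makes \<open>e\<^bsup>-rA\<^esup>\<close> (\<open>r \<ge> 0\<close>) a strongly continuous family of contractions, so that
  \<open>\<psi>\<close> depends on the data with Lipschitz constant one, while cutting off the spectrum at \<open>\<beta>\<close> costs
  the factor \<open>e\<^bsup>(\<tau>-t)\<beta>\<^esup>\<close>.  For the error, \<open>u\<^sub>\<beta>(t) = E\<^sub>\<beta> u(t)\<close>; with \<open>w = h(A) u(t)\<close> the choice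
  \<open>\<rho>\<^bsub>t,\<beta>\<^esub> = \<parallel>w - E\<^sub>\<beta> w\<parallel>\<close> works, because \<open>h(\<beta>) \<le> h\<close> on the part of the spectrum above \<open>\<beta>\<close>.
\<close>

section \<open>Spectral integrals\<close>

text \<open>The measure in the isometry changes with the vector, and
  \<open>spectral_integral\<close> selects its value by \<open>THE\<close> among limits of arbitrary
  step functions. How the value depends on the vector cannot be read off this definition; it comes
  from one approximating sequence that serves all vectors at once, which is the purpose of
  \<open>grid\<close>. The perturbed \<psi> need not lie in the domain of a growing exponential. Its
  truncated integral is therefore rewritten with the bounded integrand
  \<open>exp (c * min l \<beta>)\<close>, which coincides with the exponential on [0, \<beta>] and
  never exceeds its value at \<beta>. The error estimate stays with the spectral measure of u
  itself: the integral of the square of h is split at \<beta>, and orthogonality of the two parts of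
  \<open>w\<close> does the rest. The time integral meets a different obstacle. In a nonseparable
  space Borel functions are not closed under subtraction, so measurability is carried by almost
  everywhere limits of simple functions.\<close>

abbreviation valid_steps :: "(real \<times> real \<times> real) list \<Rightarrow> bool" where
  "valid_steps ps \<equiv> \<forall>(c, a, b)\<in>set ps. a \<le> b"

section \<open>Operations on lists of steps\<close>

definition neg_steps :: "(real \<times> real \<times> real) list \<Rightarrow> (real \<times> real \<times> real) list" where
  "neg_steps ps = map (\<lambda>(c, a, b). (- c, a, b)) ps"

text \<open>Both end points are capped, so a step beyond \<beta> stays in the list as the empty
  interval (\<beta>, \<beta>]. The same list operation then multiplies the step function by an
  indicator and applies \<open>E \<beta>\<close> to its integral.\<close>

definition cut_steps :: "real \<Rightarrow> (real \<times> real \<times> real) list \<Rightarrow> (real \<times> real \<times> real) list" where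
  "cut_steps \<beta> ps = map (\<lambda>(c, a, b). (c, min a \<beta>, min b \<beta>)) ps"

lemma step_fun_simps [simp]:
  "step_fun [] l = 0"
  "step_fun ((c, a, b) # ps) l = c * indicator {a<..b} l + step_fun ps l"
  "step_fun (ps @ qs) l = step_fun ps l + step_fun qs l"
  by (simp_all add: step_fun_def)

lemma step_integral_simps [simp]:
  "step_integral E [] x = 0"
  "step_integral E ((c, a, b) # ps) x = c *\<^sub>R (E b x - E a x) + step_integral E ps x"
  "step_integral E (ps @ qs) x = step_integral E ps x + step_integral E qs x"
  by (simp_all add: step_integral_def)

lemma step_fun_neg [simp]: "step_fun (neg_steps ps) l = - step_fun ps l"
  by (induction ps) (auto simp: neg_steps_def)

lemma step_integral_neg [simp]: "step_integral E (neg_steps ps) x = - step_integral E ps x"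
  by (induction ps) (auto simp: neg_steps_def algebra_simps)

lemma valid_neg_steps: "valid_steps ps \<Longrightarrow> valid_steps (neg_steps ps)"
  by (auto simp: neg_steps_def)

lemma valid_append_steps: "valid_steps ps \<Longrightarrow> valid_steps qs \<Longrightarrow> valid_steps (ps @ qs)"
  by auto

lemma valid_cut_steps: "valid_steps ps \<Longrightarrow> valid_steps (cut_steps \<beta> ps)"
  by (fastforce simp: cut_steps_def)

lemma step_fun_cut: "step_fun (cut_steps \<beta> ps) l = indicator {..\<beta>} l * step_fun ps l"
  by (induction ps) (auto simp: cut_steps_def algebra_simps indicator_def)

lemma borel_measurable_step_fun [measurable]: "step_fun ps \<in> borel_measurable borel"
  unfolding step_fun_def by (induction ps) auto

lemma orthogonal_projection_norm_le:
  assumes "orthogonal_projection P" shows "norm (P x) \<le> norm x"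
proof -
  have "P x \<bullet> P x = x \<bullet> P x"
    using assms unfolding orthogonal_projection_def by metis
  then have "norm (P x) * norm (P x) \<le> norm x * norm (P x)"
    by (metis norm_cauchy_schwarz dot_square_norm power2_eq_square)
  then show ?thesis
    by (cases "P x = 0") auto
qed

section \<open>Projections of a spectral family and their scalar measures\<close>

context
  fixes E :: "real \<Rightarrow> 'h::real_inner \<Rightarrow> 'h"
  assumes E: "spectral_family E"
begin

lemma spectral_projection: "orthogonal_projection (E l)"
  using E by (simp add: spectral_family_def)

lemma linear_spectral_projection: "linear (E l)"
  using spectral_projection[of l] by (simp add: orthogonal_projection_def bounded_linear.linear)

lemma spectral_projection_comp: "E l (E m x) = E (min l m) x"
  using E by (simp add: spectral_family_def)

lemma spectral_projection_inner: "E l x \<bullet> E m x = (norm (E (min l m) x))\<^sup>2"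
proof -
  have sa: "E k u \<bullet> v = u \<bullet> E k v" for k u v
    using spectral_projection[of k] by (simp add: orthogonal_projection_def)
  show ?thesis
    by (simp add: sa spectral_projection_comp power2_norm_eq_inner)
qed

lemma spectral_projection_mono:
  assumes "l \<le> m" shows "(norm (E l x))\<^sup>2 \<le> (norm (E m x))\<^sup>2"
proof -
  have "norm (E l (E m x)) \<le> norm (E m x)"
    by (rule orthogonal_projection_norm_le[OF spectral_projection])
  then show ?thesis
    using assms by (simp add: spectral_projection_comp min_absorb1 power_mono)
qed

lemma spectral_projection_right_cont: "continuous (at_right a) (\<lambda>l. (norm (E l x))\<^sup>2)"
  unfolding continuous_within
  by (intro tendsto_intros) (use E in \<open>simp add: spectral_family_def\<close>)

lemma spectral_projection_at_bot: "((\<lambda>l. (norm (E l x))\<^sup>2) \<longlongrightarrow> 0) at_bot"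
proof -
  have "((\<lambda>l. (norm (E l x))\<^sup>2) \<longlongrightarrow> (norm (0::'h))\<^sup>2) at_bot"
    by (intro tendsto_intros) (use E in \<open>simp add: spectral_family_def\<close>)
  then show ?thesis by simp
qed

lemma spectral_projection_tendsto_at_top: "((\<lambda>l. E l x) \<longlongrightarrow> x) at_top"
  using E by (simp add: spectral_family_def)

lemma sets_spectral_measure [simp, measurable_cong]:
  "sets (spectral_measure E x) = sets borel"
  by (simp add: spectral_measure_def)

lemma space_spectral_measure [simp]: "space (spectral_measure E x) = UNIV"
  by (simp add: spectral_measure_def)

lemma emeasure_spectral_measure_Iic:
  "emeasure (spectral_measure E x) {..\<beta>} = ennreal ((norm (E \<beta> x))\<^sup>2)"
  unfolding spectral_measure_def
  by (intro emeasure_interval_measure_Iic spectral_projection_mono spectral_projection_right_cont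
      spectral_projection_at_bot)

lemma emeasure_spectral_measure_UNIV:
  "emeasure (spectral_measure E x) UNIV = ennreal ((norm x)\<^sup>2)"
  unfolding spectral_measure_def
  by (intro interval_measure_UNIV spectral_projection_mono spectral_projection_right_cont
      spectral_projection_at_bot tendsto_intros spectral_projection_tendsto_at_top) auto

lemma finite_spectral_measure: "finite_measure (spectral_measure E x)"
  by (intro finite_measureI) (simp add: emeasure_spectral_measure_UNIV)

lemma measure_spectral_measure_Ioc:
  "measure (spectral_measure E x) {a<..b} =
     (if a \<le> b then (norm (E b x))\<^sup>2 - (norm (E a x))\<^sup>2 else 0)"
  unfolding spectral_measure_def
  using measure_interval_measure_Ioc[of a b "\<lambda>l. (norm (E l x))\<^sup>2",
      OF _ spectral_projection_mono spectral_projection_right_cont]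
  by auto

text \<open>Increments over disjoint intervals are orthogonal. Each of the four inner products in
  the expansion depends only on the smaller index, and they cancel to the increment over the
  overlap, or to zero if the overlap is empty.\<close>

lemma spectral_increment_inner:
  assumes "a \<le> b" "c \<le> d"
  shows "(E b x - E a x) \<bullet> (E d x - E c x) =
         measure (spectral_measure E x) ({a<..b} \<inter> {c<..d})"
proof -
  have "{a<..b} \<inter> {c<..d} = {max a c<..min b d}"
    by auto
  then show ?thesis
    using assms
    by (simp add: measure_spectral_measure_Ioc inner_diff_left inner_diff_right
        spectral_projection_inner min_def max_def)
qed

lemma step_inner_single:
  assumes "valid_steps qs" "a \<le> b"
  shows "has_bochner_integral (spectral_measure E x)
           (\<lambda>l. indicator {a<..b} l * step_fun qs l)
           ((E b x - E a x) \<bullet> step_integral E qs x)"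
  using assms(1)
proof (induction qs)
  case Nil
  then show ?case by (simp add: has_bochner_integral_zero)
next
  case (Cons q qs)
  obtain c d e where q: "q = (c, d, e)" by (cases q)
  interpret finite_measure "spectral_measure E x" by (rule finite_spectral_measure)
  have "has_bochner_integral (spectral_measure E x) (indicator ({a<..b} \<inter> {d<..e}))
          (measure (spectral_measure E x) ({a<..b} \<inter> {d<..e}))"
    by (intro has_bochner_integral_real_indicator) (auto simp: less_top[symmetric])
  then have "has_bochner_integral (spectral_measure E x)
      (\<lambda>l. c * indicator ({a<..b} \<inter> {d<..e}) l + indicator {a<..b} l * step_fun qs l)
      (c * ((E b x - E a x) \<bullet> (E e x - E d x)) + (E b x - E a x) \<bullet> step_integral E qs x)"
    using Cons q assms(2)
    by (intro has_bochner_integral_add has_bochner_integral_mult_right Cons.IH)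
       (auto simp: spectral_increment_inner)
  then show ?case
    by (simp add: q inner_add_right algebra_simps flip: indicator_inter_arith)
qed

text \<open>The polarized form of the isometry. Two independent lists make the claim bilinear, so
  that each list can be handled by induction; the square of a single step function has no such
  induction.\<close>

lemma step_inner:
  assumes "valid_steps ps" "valid_steps qs"
  shows "has_bochner_integral (spectral_measure E x) (\<lambda>l. step_fun ps l * step_fun qs l)
           (step_integral E ps x \<bullet> step_integral E qs x)"
  using assms(1)
proof (induction ps)
  case Nil
  then show ?case by (simp add: has_bochner_integral_zero)
next
  case (Cons q ps)
  obtain c d e where q: "q = (c, d, e)" by (cases q)
  have "has_bochner_integral (spectral_measure E x)
      (\<lambda>l. c * (indicator {d<..e} l * step_fun qs l) + step_fun ps l * step_fun qs l)
      (c * ((E e x - E d x) \<bullet> step_integral E qs x) + step_integral E ps x \<bullet> step_integral E qs x)"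
    using Cons q assms(2)
    by (intro has_bochner_integral_add has_bochner_integral_mult_right step_inner_single) auto
  then show ?case
    by (simp add: q inner_add_left algebra_simps)
qed

lemma step_isometry:
  assumes "valid_steps ps"
  shows "(\<integral>\<^sup>+l. ennreal ((step_fun ps l)\<^sup>2) \<partial>spectral_measure E x) =
         ennreal ((norm (step_integral E ps x))\<^sup>2)"
  using step_inner[OF assms assms, of x]
  by (subst nn_integral_eq_integral)
     (auto simp: has_bochner_integral_iff power2_eq_square dot_square_norm)

lemma step_integral_linear: "linear (step_integral E ps)"
proof (rule linearI)
  show "step_integral E ps (x + y) = step_integral E ps x + step_integral E ps y" for x y
    by (induction ps) (auto simp: linear_add[OF linear_spectral_projection] algebra_simps)
  show "step_integral E ps (c *\<^sub>R x) = c *\<^sub>R step_integral E ps x" for c x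
    by (induction ps) (auto simp: linear_scale[OF linear_spectral_projection] algebra_simps)
qed

lemma step_integral_cut: "step_integral E (cut_steps \<beta> ps) x = E \<beta> (step_integral E ps x)"
  by (induction ps)
     (auto simp: cut_steps_def spectral_projection_comp min.commute
       linear_add[OF linear_spectral_projection] linear_diff[OF linear_spectral_projection]
       linear_scale[OF linear_spectral_projection] linear_0[OF linear_spectral_projection])

end

text \<open>A crude triangle inequality in squared form. Asking only for a pointwise bound on
  \<open>w\<close> lets it serve sums and differences alike.\<close>

lemma nn_integral_square_add_le:
  fixes u v w :: "'a \<Rightarrow> real"
  assumes [measurable]: "u \<in> borel_measurable M" "v \<in> borel_measurable M"
    and w: "\<And>l. \<bar>w l\<bar> \<le> \<bar>u l\<bar> + \<bar>v l\<bar>"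
  shows "(\<integral>\<^sup>+l. ennreal ((w l)\<^sup>2) \<partial>M) \<le>
    2 * (\<integral>\<^sup>+l. ennreal ((u l)\<^sup>2) \<partial>M) + 2 * (\<integral>\<^sup>+l. ennreal ((v l)\<^sup>2) \<partial>M)"
proof -
  have "ennreal ((w l)\<^sup>2) \<le> 2 * ennreal ((u l)\<^sup>2) + 2 * ennreal ((v l)\<^sup>2)" for l
  proof -
    have "(w l)\<^sup>2 \<le> (\<bar>u l\<bar> + \<bar>v l\<bar>)\<^sup>2"
      using w[of l] by (metis abs_ge_zero power_mono power2_abs)
    also have "\<dots> \<le> 2 * (u l)\<^sup>2 + 2 * (v l)\<^sup>2"
      using sum_squares_bound[of "\<bar>u l\<bar>" "\<bar>v l\<bar>"] by (simp add: power2_sum)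
    finally have "ennreal ((w l)\<^sup>2) \<le> ennreal (2 * (u l)\<^sup>2 + 2 * (v l)\<^sup>2)"
      by (rule ennreal_leI)
    also have "\<dots> = 2 * ennreal ((u l)\<^sup>2) + 2 * ennreal ((v l)\<^sup>2)"
      by (simp add: ennreal_plus ennreal_mult)
    finally show ?thesis .
  qed
  then have "(\<integral>\<^sup>+l. ennreal ((w l)\<^sup>2) \<partial>M) \<le>
      (\<integral>\<^sup>+l. 2 * ennreal ((u l)\<^sup>2) + 2 * ennreal ((v l)\<^sup>2) \<partial>M)"
    by (rule nn_integral_mono)
  also have "\<dots> = 2 * (\<integral>\<^sup>+l. ennreal ((u l)\<^sup>2) \<partial>M) + 2 * (\<integral>\<^sup>+l. ennreal ((v l)\<^sup>2) \<partial>M)"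
    by (simp add: nn_integral_add nn_integral_cmult)
  finally show ?thesis .
qed

text \<open>A substitute for Minkowski's inequality that avoids square roots and subtraction in
  \<open>ennreal\<close>. When the distance of \<open>u\<close> and \<open>v\<close> tends to 0, the
  last term vanishes for fixed \<open>e\<close>, and the factor \<open>1 + e\<close> is removed
  afterwards.\<close>

lemma nn_integral_square_add_le_eps:
  fixes u v :: "'a \<Rightarrow> real"
  assumes [measurable]: "u \<in> borel_measurable M" "v \<in> borel_measurable M" and "e > 0"
  shows "(\<integral>\<^sup>+l. ennreal ((u l)\<^sup>2) \<partial>M) \<le>
    ennreal (1 + e) * (\<integral>\<^sup>+l. ennreal ((v l)\<^sup>2) \<partial>M)
    + ennreal (1 + 1 / e) * (\<integral>\<^sup>+l. ennreal ((u l - v l)\<^sup>2) \<partial>M)"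
proof -
  have "ennreal ((u l)\<^sup>2) \<le>
      ennreal (1 + e) * ennreal ((v l)\<^sup>2) + ennreal (1 + 1 / e) * ennreal ((u l - v l)\<^sup>2)" for l
  proof -
    define s where "s = sqrt e"
    have s: "s > 0" "e = s * s"
      using \<open>e > 0\<close> by (auto simp: s_def)
    \<comment> \<open>Completing the square: the mixed term 2 v (u - v) is weighted by s and 1/s
      with s the square root of \<open>e\<close>, and the square on the left is what the inequality
      discards.\<close>
    have "(u l)\<^sup>2 + (s * v l - (u l - v l) / s)\<^sup>2 =
        (1 + e) * (v l)\<^sup>2 + (1 + 1 / e) * (u l - v l)\<^sup>2"
      using s(1) unfolding s(2) by (simp add: power2_eq_square field_simps)
    then have "(u l)\<^sup>2 \<le> (1 + e) * (v l)\<^sup>2 + (1 + 1 / e) * (u l - v l)\<^sup>2"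
      by (smt (verit) zero_le_power2)
    then have "ennreal ((u l)\<^sup>2) \<le> ennreal ((1 + e) * (v l)\<^sup>2 + (1 + 1 / e) * (u l - v l)\<^sup>2)"
      by (rule ennreal_leI)
    also have "\<dots> = ennreal (1 + e) * ennreal ((v l)\<^sup>2) + ennreal (1 + 1 / e) * ennreal ((u l - v l)\<^sup>2)"
      using \<open>e > 0\<close> by (simp add: ennreal_plus ennreal_mult)
    finally show ?thesis .
  qed
  then have "(\<integral>\<^sup>+l. ennreal ((u l)\<^sup>2) \<partial>M) \<le>
      (\<integral>\<^sup>+l. ennreal (1 + e) * ennreal ((v l)\<^sup>2) + ennreal (1 + 1 / e) * ennreal ((u l - v l)\<^sup>2) \<partial>M)"
    by (rule nn_integral_mono)
  also have "\<dots> = ennreal (1 + e) * (\<integral>\<^sup>+l. ennreal ((v l)\<^sup>2) \<partial>M)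
    + ennreal (1 + 1 / e) * (\<integral>\<^sup>+l. ennreal ((u l - v l)\<^sup>2) \<partial>M)"
    by (simp add: nn_integral_add nn_integral_cmult)
  finally show ?thesis .
qed

lemma le_of_le_one_plus_eps_mult:
  fixes a b :: real
  assumes "\<And>e. e > 0 \<Longrightarrow> a \<le> (1 + e) * b"
  shows "a \<le> b"
proof (rule tendsto_lowerbound)
  have "((\<lambda>e. (1 + e) * b) \<longlongrightarrow> (1 + 0) * b) (at_right 0)"
    by (intro tendsto_intros)
  then show "((\<lambda>e. (1 + e) * b) \<longlongrightarrow> b) (at_right 0)"
    by simp
  show "eventually (\<lambda>e. a \<le> (1 + e) * b) (at_right 0)"
    using assms by (auto simp: eventually_at_right_less eventually_at_filter)
qed simp

section \<open>Step function approximation\<close>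

text \<open>Sampling at left end points with mesh 1/(n+1) on (0, n+1], which takes (n+1) squared
  steps. Steps are open on the left and would miss an atom at 0; the extra first step, shrinking to
  the point 0 from the left, catches it. The list depends on \<open>g\<close> and \<open>n\<close>
  only, never on a vector.\<close>

definition grid :: "(real \<Rightarrow> real) \<Rightarrow> nat \<Rightarrow> (real \<times> real \<times> real) list" where
  "grid g n = (g 0, - 1 / real (Suc n), 0) #
     map (\<lambda>k. (g (real k / real (Suc n)), real k / real (Suc n), real (Suc k) / real (Suc n)))
       [0..<Suc n * Suc n]"

lemma valid_grid: "valid_steps (grid g n)"
  by (auto simp: grid_def divide_right_mono)

lemma step_fun_grid_nonpos:
  assumes "l \<le> 0"
  shows "step_fun (grid g n) l = g 0 * indicator {- 1 / real (Suc n)<..} l"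
proof -
  have "(\<Sum>k\<leftarrow>[0..<Suc n * Suc n]. g (real k / real (Suc n)) *
      indicator {real k / real (Suc n)<..real (Suc k) / real (Suc n)} l) = (\<Sum>k\<leftarrow>[0..<Suc n * Suc n]. (0::real))"
    using assms
    by (intro arg_cong[where f = sum_list] map_cong refl)
       (auto simp: indicator_def not_less intro: order_trans[OF assms])
  then show ?thesis
    using assms by (simp add: grid_def step_fun_def comp_def indicator_def del: upt_Suc of_nat_Suc)
qed

lemma step_fun_grid_pos:
  assumes "l > 0" and j: "real j < l * real (Suc n)" "l * real (Suc n) \<le> real (Suc j)"
  shows "step_fun (grid g n) l = (if j < Suc n * Suc n then g (real j / real (Suc n)) else 0)"
proof -
  have ind: "indicator {real k / real (Suc n)<..real (Suc k) / real (Suc n)} l = (of_bool (k = j) :: real)" for k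
  proof -
    have "real k < l * real (Suc n) \<and> l * real (Suc n) \<le> real (Suc k) \<longleftrightarrow> k = j"
      using j by (auto simp del: of_nat_Suc)
    then show ?thesis
      by (auto simp: indicator_def pos_divide_less_eq pos_le_divide_eq simp del: of_nat_Suc)
  qed
  have "step_fun (grid g n) l = (\<Sum>k\<leftarrow>[0..<Suc n * Suc n]. g (real k / real (Suc n)) * of_bool (k = j))"
    using assms(1) by (simp add: grid_def step_fun_def comp_def ind del: upt_Suc of_nat_Suc)
  also have "\<dots> = (\<Sum>k\<in>{0..<Suc n * Suc n}. if k = j then g (real k / real (Suc n)) else 0)"
    unfolding interv_sum_list_conv_sum_set_nat set_upt
    by (intro sum.cong) auto
  also have "\<dots> = (if j < Suc n * Suc n then g (real j / real (Suc n)) else 0)"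
    by (subst sum.delta) auto
  finally show ?thesis .
qed

lemma grid_index:
  assumes "l > 0"
  obtains j where "real j < l * real (Suc n)" "l * real (Suc n) \<le> real (Suc j)"
proof
  let ?r = "l * real (Suc n)"
  have r: "?r > 0"
    using assms by simp
  then have "\<lceil>?r\<rceil> \<ge> 1"
    by linarith
  \<comment> \<open>The ceiling minus one rather than the floor, because the cells are open on the
    left and closed on the right.\<close>
  then have "real (nat (\<lceil>?r\<rceil> - 1)) = of_int \<lceil>?r\<rceil> - 1"
    by simp
  then show "real (nat (\<lceil>?r\<rceil> - 1)) < ?r" "?r \<le> real (Suc (nat (\<lceil>?r\<rceil> - 1)))"
    by linarith+
qed

text \<open>This is what domination requires: an approximant at \<open>l\<close> never samples
  \<open>g\<close> to the right of \<open>l\<close>, so a bound for \<open>g\<close> on [0, max l 0]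
  controls all of them.\<close>

lemma step_fun_grid_cases:
  "step_fun (grid g n) l = 0 \<or> (\<exists>a\<in>{0..max l 0}. step_fun (grid g n) l = g a)"
proof (cases "l > 0")
  case True
  obtain j where j: "real j < l * real (Suc n)" "l * real (Suc n) \<le> real (Suc j)"
    using grid_index[OF True] .
  then have "real j / real (Suc n) \<in> {0..max l 0}"
    using True by (auto simp: pos_divide_le_eq simp del: of_nat_Suc)
  then show ?thesis
    using step_fun_grid_pos[OF True j, of g] by auto
next
  case False
  then show ?thesis
    using step_fun_grid_nonpos[of l g n] by (auto simp: indicator_def)
qed

lemma step_fun_grid_tendsto:
  assumes "continuous_on {0..} g"
  shows "(\<lambda>n. step_fun (grid g n) l) \<longlonglongrightarrow> indicator {0..} l * g l"
proof -
  consider "l < 0" | "l = 0" | "l > 0" by linarith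
  then show ?thesis
  proof cases
    case 1
    have "(\<lambda>n. - 1 / real (Suc n)) \<longlonglongrightarrow> 0"
      using LIMSEQ_Suc[OF lim_1_over_n, THEN tendsto_minus] by simp
    then have "eventually (\<lambda>n. - 1 / real (Suc n) > l) sequentially"
      using 1 by (rule order_tendstoD)
    then have "eventually (\<lambda>n. step_fun (grid g n) l = indicator {0..} l * g l) sequentially"
      by eventually_elim (use 1 in \<open>simp add: step_fun_grid_nonpos indicator_def del: of_nat_Suc\<close>)
    then show ?thesis
      by (rule tendsto_eventually)
  next
    case 2
    then show ?thesis
      by (simp add: step_fun_grid_nonpos indicator_def divide_less_0_iff)
  next
    case 3
    have "\<exists>j. real j < l * real (Suc n) \<and> l * real (Suc n) \<le> real (Suc j)" for n
      using grid_index[OF 3] by metis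
    then obtain j where j: "\<And>n. real (j n) < l * real (Suc n)" "\<And>n. l * real (Suc n) \<le> real (Suc (j n))"
      by metis
    have "(\<lambda>n. real (j n) / real (Suc n)) \<longlonglongrightarrow> l"
    proof (rule tendsto_sandwich)
      have "(\<lambda>n. l - 1 / real (Suc n)) \<longlonglongrightarrow> l - 0"
        using LIMSEQ_Suc[OF lim_1_over_n] by (intro tendsto_diff tendsto_const)
      then show "(\<lambda>n. l - 1 / real (Suc n)) \<longlonglongrightarrow> l"
        by simp
      show "eventually (\<lambda>n. l - 1 / real (Suc n) \<le> real (j n) / real (Suc n)) sequentially"
      proof (intro always_eventually allI)
        fix n
        have "l \<le> real (Suc (j n)) / real (Suc n)"
          using j(2)[of n] by (subst pos_le_divide_eq) auto
        then show "l - 1 / real (Suc n) \<le> real (j n) / real (Suc n)"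
          by (simp add: add_divide_distrib)
      qed
      show "eventually (\<lambda>n. real (j n) / real (Suc n) \<le> l) sequentially"
        using j(1) by (auto simp: pos_divide_le_eq less_imp_le simp del: of_nat_Suc intro!: always_eventually)
    qed (rule tendsto_const)
    then have lim: "(\<lambda>n. g (real (j n) / real (Suc n))) \<longlonglongrightarrow> g l"
      by (rule continuous_on_tendsto_compose[OF assms]) (use 3 in auto)
    \<comment> \<open>Once n \<ge> l, the index satisfies j < l (n+1) < (n+1)(n+1), so the cell of
      \<open>l\<close> belongs to the finite grid.\<close>
    have "eventually (\<lambda>n. l \<le> real n) sequentially"
      using eventually_ge_at_top[of "nat \<lceil>l\<rceil>"] by eventually_elim linarith
    then have "eventually (\<lambda>n. g (real (j n) / real (Suc n)) = step_fun (grid g n) l) sequentially"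
    proof eventually_elim
      case (elim n)
      have "real (j n) < real (Suc n) * real (Suc n)"
        using j(1)[of n] elim by (smt (verit) mult_right_mono of_nat_0_le_iff of_nat_Suc)
      then have "j n < Suc n * Suc n"
        by (metis of_nat_less_iff of_nat_mult)
      then show ?case
        using step_fun_grid_pos[OF 3 j, of g n] by simp
    qed
    then have "(\<lambda>n. step_fun (grid g n) l) \<longlonglongrightarrow> g l"
      using lim by (rule Lim_transform_eventually[rotated])
    then show ?thesis
      using 3 by simp
  qed
qed

section \<open>Existence and uniqueness of spectral integrals\<close>

lemma has_spectral_integralD_measurable:
  assumes "has_spectral_integral E S g x y"
  shows "set_borel_measurable borel S g"
  using assms by (simp add: has_spectral_integral_def)

lemma has_spectral_integralI:
  assumes "set_borel_measurable borel S g"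
    and "\<And>n. valid_steps (ps n)"
    and "(\<lambda>n. \<integral>\<^sup>+l. ennreal ((indicator S l * g l - step_fun (ps n) l)\<^sup>2) \<partial>spectral_measure E x) \<longlonglongrightarrow> 0"
    and "(\<lambda>n. step_integral E (ps n) x) \<longlonglongrightarrow> y"
  shows "has_spectral_integral E S g x y"
  unfolding has_spectral_integral_def using assms by (intro conjI exI[of _ ps] allI)

lemma has_spectral_integralE:
  assumes "has_spectral_integral E S g x y"
  obtains ps where "\<And>n. valid_steps (ps n)"
    and "(\<lambda>n. \<integral>\<^sup>+l. ennreal ((indicator S l * g l - step_fun (ps n) l)\<^sup>2) \<partial>spectral_measure E x) \<longlonglongrightarrow> 0"
    and "(\<lambda>n. step_integral E (ps n) x) \<longlonglongrightarrow> y"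
  using assms unfolding has_spectral_integral_def by auto

lemma has_spectral_integral_cong:
  assumes "\<And>l. indicator S l * g l = indicator T l * h l"
  shows "has_spectral_integral E S g x y \<longleftrightarrow> has_spectral_integral E T h x y"
  using assms by (simp add: has_spectral_integral_def set_borel_measurable_def)

context
  fixes E :: "real \<Rightarrow> 'h::real_inner \<Rightarrow> 'h"
  assumes E: "spectral_family E"
begin

lemmas [simp, measurable_cong] = sets_spectral_measure[OF E]
lemmas [simp] = space_spectral_measure[OF E]

lemma borel_measurable_minus_step_fun:
  assumes "set_borel_measurable borel S g"
  shows "(\<lambda>l. indicator S l * g l) \<in> borel_measurable (spectral_measure E x)"
    and "(\<lambda>l. indicator S l * g l - step_fun ps l) \<in> borel_measurable (spectral_measure E x)"
    and "step_fun ps \<in> borel_measurable (spectral_measure E x)"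
proof -
  show *: "(\<lambda>l. indicator S l * g l) \<in> borel_measurable (spectral_measure E x)"
    using assms by (simp add: set_borel_measurable_def cong: measurable_cong_sets)
  show **: "step_fun ps \<in> borel_measurable (spectral_measure E x)"
    by measurable
  show "(\<lambda>l. indicator S l * g l - step_fun ps l) \<in> borel_measurable (spectral_measure E x)"
    by (rule borel_measurable_diff[OF * **])
qed

lemma has_spectral_integral_diff:
  assumes "has_spectral_integral E S g x y" "has_spectral_integral E S g' x y'"
  shows "has_spectral_integral E S (\<lambda>l. g l - g' l) x (y - y')"
proof -
  note meas = assms[THEN has_spectral_integralD_measurable]
  let ?M = "spectral_measure E x"
  obtain ps where ps: "\<And>n. valid_steps (ps n)"
    "(\<lambda>n. \<integral>\<^sup>+l. ennreal ((indicator S l * g l - step_fun (ps n) l)\<^sup>2) \<partial>?M) \<longlonglongrightarrow> 0"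
    "(\<lambda>n. step_integral E (ps n) x) \<longlonglongrightarrow> y"
    using assms(1) by (rule has_spectral_integralE) blast
  obtain qs where qs: "\<And>n. valid_steps (qs n)"
    "(\<lambda>n. \<integral>\<^sup>+l. ennreal ((indicator S l * g' l - step_fun (qs n) l)\<^sup>2) \<partial>?M) \<longlonglongrightarrow> 0"
    "(\<lambda>n. step_integral E (qs n) x) \<longlonglongrightarrow> y'"
    using assms(2) by (rule has_spectral_integralE) blast
  \<comment> \<open>Appending the negated list subtracts both the step functions and their
    integrals.\<close>
  let ?rs = "\<lambda>n. ps n @ neg_steps (qs n)"
  have "(\<lambda>n. \<integral>\<^sup>+l. ennreal ((indicator S l * (g l - g' l) - step_fun (?rs n) l)\<^sup>2) \<partial>?M) \<longlonglongrightarrow> 0"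
  proof (rule tendsto_sandwich[OF _ _ tendsto_const])
    have "(\<lambda>n. 2 * (\<integral>\<^sup>+l. ennreal ((indicator S l * g l - step_fun (ps n) l)\<^sup>2) \<partial>?M) +
        2 * (\<integral>\<^sup>+l. ennreal ((indicator S l * g' l - step_fun (qs n) l)\<^sup>2) \<partial>?M)) \<longlonglongrightarrow> 2 * 0 + 2 * 0"
      by (intro tendsto_intros ps qs ennreal_tendsto_cmult) auto
    then show "(\<lambda>n. 2 * (\<integral>\<^sup>+l. ennreal ((indicator S l * g l - step_fun (ps n) l)\<^sup>2) \<partial>?M) +
        2 * (\<integral>\<^sup>+l. ennreal ((indicator S l * g' l - step_fun (qs n) l)\<^sup>2) \<partial>?M)) \<longlonglongrightarrow> 0"
      by simp
    show "eventually (\<lambda>n. (\<integral>\<^sup>+l. ennreal ((indicator S l * (g l - g' l) - step_fun (?rs n) l)\<^sup>2) \<partial>?M)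
       \<le> 2 * (\<integral>\<^sup>+l. ennreal ((indicator S l * g l - step_fun (ps n) l)\<^sup>2) \<partial>?M) +
        2 * (\<integral>\<^sup>+l. ennreal ((indicator S l * g' l - step_fun (qs n) l)\<^sup>2) \<partial>?M)) sequentially"
      by (intro always_eventually allI nn_integral_square_add_le borel_measurable_minus_step_fun meas)
         (auto simp: algebra_simps)
  qed auto
  moreover have "(\<lambda>n. step_integral E (?rs n) x) \<longlonglongrightarrow> y - y'"
    using tendsto_diff[OF ps(3) qs(3)] by simp
  moreover have "(\<lambda>l. indicator S l * g l - indicator S l * g' l) \<in> borel_measurable borel"
    using meas unfolding set_borel_measurable_def real_scaleR_def by (rule borel_measurable_diff)
  then have "set_borel_measurable borel S (\<lambda>l. g l - g' l)"
    by (simp add: set_borel_measurable_def right_diff_distrib)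
  moreover have "valid_steps (?rs n)" for n
    by (intro valid_append_steps valid_neg_steps ps qs)
  ultimately show ?thesis
    by (intro has_spectral_integralI)
qed

text \<open>The isometry for step functions passes to the limit. \<open>le1\<close> compares the
  integrand with its approximants and \<open>le2\<close> the approximants with the integrand, each
  up to a factor \<open>1 + e\<close>.\<close>

lemma has_spectral_integral_isometry:
  assumes "has_spectral_integral E S g x y"
  shows "(\<integral>\<^sup>+l. ennreal ((indicator S l * g l)\<^sup>2) \<partial>spectral_measure E x) = ennreal ((norm y)\<^sup>2)"
proof -
  note meas = assms[THEN has_spectral_integralD_measurable]
  let ?M = "spectral_measure E x"
  obtain ps where ps: "\<And>n. valid_steps (ps n)"
    "(\<lambda>n. \<integral>\<^sup>+l. ennreal ((indicator S l * g l - step_fun (ps n) l)\<^sup>2) \<partial>?M) \<longlonglongrightarrow> 0"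
    "(\<lambda>n. step_integral E (ps n) x) \<longlonglongrightarrow> y"
    using assms(1) by (rule has_spectral_integralE) blast
  define K where "K = (\<integral>\<^sup>+l. ennreal ((indicator S l * g l)\<^sup>2) \<partial>?M)"
  define d where "d n = (\<integral>\<^sup>+l. ennreal ((indicator S l * g l - step_fun (ps n) l)\<^sup>2) \<partial>?M)" for n
  define Y where "Y n = (norm (step_integral E (ps n) x))\<^sup>2" for n
  have d: "d \<longlonglongrightarrow> 0"
    using ps(2) unfolding d_def[abs_def] .
  have Y: "(\<lambda>n. ennreal (Y n)) \<longlonglongrightarrow> ennreal ((norm y)\<^sup>2)"
    unfolding Y_def by (intro tendsto_intros ps)
  have eq: "ennreal (Y n) = (\<integral>\<^sup>+l. ennreal ((step_fun (ps n) l)\<^sup>2) \<partial>?M)" for n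
    unfolding Y_def by (rule step_isometry[OF E ps(1), symmetric])
  have le1: "K \<le> ennreal (1 + e) * ennreal ((norm y)\<^sup>2)" if "e > 0" for e
  proof (rule tendsto_lowerbound)
    have "(\<lambda>n. ennreal (1 + e) * ennreal (Y n) + ennreal (1 + 1 / e) * d n)
        \<longlonglongrightarrow> ennreal (1 + e) * ennreal ((norm y)\<^sup>2) + ennreal (1 + 1 / e) * 0"
      by (intro tendsto_intros d Y ennreal_tendsto_cmult) auto
    then show "(\<lambda>n. ennreal (1 + e) * ennreal (Y n) + ennreal (1 + 1 / e) * d n)
        \<longlonglongrightarrow> ennreal (1 + e) * ennreal ((norm y)\<^sup>2)"
      by simp
    show "eventually (\<lambda>n. K \<le> ennreal (1 + e) * ennreal (Y n) + ennreal (1 + 1 / e) * d n) sequentially"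
      unfolding eq K_def d_def
      by (intro always_eventually allI nn_integral_square_add_le_eps that borel_measurable_minus_step_fun[OF meas])
  qed simp
  have le2: "ennreal ((norm y)\<^sup>2) \<le> ennreal (1 + e) * K" if "e > 0" for e
  proof (rule tendsto_le[OF _ _ Y])
    have "(\<lambda>n. ennreal (1 + e) * K + ennreal (1 + 1 / e) * d n)
        \<longlonglongrightarrow> ennreal (1 + e) * K + ennreal (1 + 1 / e) * 0"
      by (intro tendsto_intros d ennreal_tendsto_cmult) auto
    then show "(\<lambda>n. ennreal (1 + e) * K + ennreal (1 + 1 / e) * d n)
        \<longlonglongrightarrow> ennreal (1 + e) * K"
      by simp
    have "d n = (\<integral>\<^sup>+l. ennreal ((step_fun (ps n) l - indicator S l * g l)\<^sup>2) \<partial>?M)" for n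
      by (simp add: d_def power2_commute)
    then show "eventually (\<lambda>n. ennreal (Y n) \<le> ennreal (1 + e) * K + ennreal (1 + 1 / e) * d n) sequentially"
      unfolding eq K_def
      by (intro always_eventually allI) (simp, intro nn_integral_square_add_le_eps that borel_measurable_minus_step_fun[OF meas])
  qed simp
  \<comment> \<open>Finiteness of \<open>K\<close> is itself a consequence of \<open>le1\<close>;
    only after this can the two estimates be read in the reals and \<open>e\<close> sent to
    0.\<close>
  have "K < top"
    by (rule le_less_trans[OF le1[of 1]]) (auto simp: ennreal_mult_less_top)
  then obtain k where k: "k \<ge> 0" "K = ennreal k"
    by (cases K) auto
  have mult: "ennreal (1 + e) * ennreal r = ennreal ((1 + e) * r)" if "e > 0" for e r
    using that by (intro ennreal_mult'[symmetric]) auto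
  have "k \<le> (norm y)\<^sup>2"
  proof (rule le_of_le_one_plus_eps_mult)
    show "k \<le> (1 + e) * (norm y)\<^sup>2" if "e > 0" for e
      using le1[OF that] that unfolding k(2) mult[OF that] by (subst (asm) ennreal_le_iff) auto
  qed
  moreover have "(norm y)\<^sup>2 \<le> k"
  proof (rule le_of_le_one_plus_eps_mult)
    show "(norm y)\<^sup>2 \<le> (1 + e) * k" if "e > 0" for e
      using le2[OF that] that k(1) unfolding k(2) mult[OF that] by (subst (asm) ennreal_le_iff) auto
  qed
  ultimately show ?thesis
    using k by (simp add: K_def)
qed

text \<open>The difference of two values is a spectral integral of the zero function, whose norm
  vanishes by the isometry. This gives meaning to the \<open>THE\<close> in
  \<open>spectral_integral\<close>.\<close>

lemma has_spectral_integral_unique: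
  assumes "has_spectral_integral E S g x y" "has_spectral_integral E S g x y'"
  shows "y = y'"
  using has_spectral_integral_isometry[OF has_spectral_integral_diff[OF assms]] by simp

lemma spectral_integral_eqI:
  assumes "has_spectral_integral E S g x y"
  shows "spectral_integral E S g x = y"
  unfolding spectral_integral_def
  using assms has_spectral_integral_unique by (intro the_equality) blast+

text \<open>Cutting every approximant at \<beta> only decreases the pointwise error, and the
  integrals converge because \<open>E \<beta>\<close> is continuous.\<close>

lemma has_spectral_integral_cut:
  assumes "has_spectral_integral E S g x y"
  shows "has_spectral_integral E (S \<inter> {..\<beta>}) g x (E \<beta> y)"
proof -
  note meas = assms[THEN has_spectral_integralD_measurable]
  let ?M = "spectral_measure E x"
  obtain ps where ps: "\<And>n. valid_steps (ps n)"
    "(\<lambda>n. \<integral>\<^sup>+l. ennreal ((indicator S l * g l - step_fun (ps n) l)\<^sup>2) \<partial>?M) \<longlonglongrightarrow> 0"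
    "(\<lambda>n. step_integral E (ps n) x) \<longlonglongrightarrow> y"
    using assms(1) by (rule has_spectral_integralE) blast
  have "(\<lambda>n. \<integral>\<^sup>+l. ennreal ((indicator (S \<inter> {..\<beta>}) l * g l - step_fun (cut_steps \<beta> (ps n)) l)\<^sup>2) \<partial>?M) \<longlonglongrightarrow> 0"
    by (rule tendsto_sandwich[OF _ _ tendsto_const ps(2)])
       (auto intro!: always_eventually nn_integral_mono ennreal_leI simp: step_fun_cut indicator_def)
  moreover have "(\<lambda>n. step_integral E (cut_steps \<beta> (ps n)) x) \<longlonglongrightarrow> E \<beta> y"
    unfolding step_integral_cut[OF E]
    using spectral_projection[OF E, of \<beta>] ps(3)
    by (auto simp: orthogonal_projection_def intro: bounded_linear.tendsto)
  moreover have "(\<lambda>l. indicator {..\<beta>} l * (indicator S l * g l)) \<in> borel_measurable borel"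
    using meas unfolding set_borel_measurable_def real_scaleR_def by (rule borel_measurable_times[OF borel_measurable_indicator[OF borel_closed[OF closed_atMost]]])
  then have "set_borel_measurable borel (S \<inter> {..\<beta>}) g"
    by (simp add: set_borel_measurable_def indicator_inter_arith mult_ac)
  moreover have "valid_steps (cut_steps \<beta> (ps n))" for n
    by (rule valid_cut_steps[OF ps(1)])
  ultimately show ?thesis
    by (intro has_spectral_integralI)
qed

end

text \<open>Convergence in L2 of the spectral measure makes the step integrals Cauchy through the
  isometry; completeness of the space supplies the limit. The conclusion speaks of the given
  sequence, so that one sequence can later be compared across different vectors.\<close>

lemma has_spectral_integral_of_approx:
  fixes E :: "real \<Rightarrow> 'h::{real_inner, banach} \<Rightarrow> 'h"
  assumes E: "spectral_family E" and g: "set_borel_measurable borel S g"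
    and ps: "\<And>n. valid_steps (ps n)"
    and lim: "(\<lambda>n. \<integral>\<^sup>+l. ennreal ((indicator S l * g l - step_fun (ps n) l)\<^sup>2) \<partial>spectral_measure E x) \<longlonglongrightarrow> 0"
  obtains y where "(\<lambda>n. step_integral E (ps n) x) \<longlonglongrightarrow> y" "has_spectral_integral E S g x y"
proof -
  note [simp, measurable_cong] = sets_spectral_measure[OF E]
  let ?M = "spectral_measure E x"
  define d where "d n = (\<integral>\<^sup>+l. ennreal ((indicator S l * g l - step_fun (ps n) l)\<^sup>2) \<partial>?M)" for n
  have diff: "ennreal ((norm (step_integral E (ps m) x - step_integral E (ps n) x))\<^sup>2) \<le> 2 * d m + 2 * d n" for m n
  proof -
    have "ennreal ((norm (step_integral E (ps m @ neg_steps (ps n)) x))\<^sup>2) =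
       (\<integral>\<^sup>+l. ennreal ((step_fun (ps m @ neg_steps (ps n)) l)\<^sup>2) \<partial>?M)"
      by (rule step_isometry[OF E, symmetric]) (intro valid_append_steps valid_neg_steps ps)
    also have "\<dots> \<le> 2 * d m + 2 * d n"
      unfolding d_def by (intro nn_integral_square_add_le borel_measurable_minus_step_fun[OF E] g) auto
    finally show ?thesis by simp
  qed
  have "Cauchy (\<lambda>n. step_integral E (ps n) x)"
  proof (rule metric_CauchyI)
    fix e :: real assume "e > 0"
    \<comment> \<open>With both errors below a quarter of the square of \<open>e\<close>, the
      doubled errors in \<open>diff\<close> add up to less than the square of
      \<open>e\<close>.\<close>
    then have "eventually (\<lambda>n. d n < ennreal (e\<^sup>2 / 4)) sequentially"
      using lim by (intro order_tendstoD) (auto simp: d_def)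
    then obtain N where N: "\<And>n. n \<ge> N \<Longrightarrow> d n < ennreal (e\<^sup>2 / 4)"
      by (auto simp: eventually_sequentially)
    have "dist (step_integral E (ps m) x) (step_integral E (ps n) x) < e" if mn: "m \<ge> N" "n \<ge> N" for m n
    proof -
      have d2: "2 * d k < ennreal (e\<^sup>2 / 2)" if "k \<ge> N" for k
      proof -
        have "2 * d k < 2 * ennreal (e\<^sup>2 / 4)"
          using N[OF that] by (intro ennreal_mult_strict_left_mono) auto
        also have "2 * ennreal (e\<^sup>2 / 4) = ennreal (2 * (e\<^sup>2 / 4))"
          by (subst ennreal_mult) auto
        finally show ?thesis
          by simp
      qed
      have "ennreal ((norm (step_integral E (ps m) x - step_integral E (ps n) x))\<^sup>2) < ennreal (e\<^sup>2 / 2) + ennreal (e\<^sup>2 / 2)"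
        using diff d2[OF mn(1)] d2[OF mn(2)] by (meson add_strict_mono le_less_trans)
      also have "\<dots> = ennreal (e\<^sup>2)"
        by (simp flip: ennreal_plus)
      finally show ?thesis
        using \<open>e > 0\<close> unfolding dist_norm
        by - (rule power_less_imp_less_base[of _ 2], auto simp: ennreal_less_iff)
    qed
    then show "\<exists>N. \<forall>m\<ge>N. \<forall>n\<ge>N. dist (step_integral E (ps m) x) (step_integral E (ps n) x) < e"
      by blast
  qed
  then obtain y where "(\<lambda>n. step_integral E (ps n) x) \<longlonglongrightarrow> y"
    using Cauchy_convergent_iff convergentD by blast
  then show ?thesis
    using that has_spectral_integralI[OF g ps lim] by blast
qed

section \<open>Existence for continuous integrands\<close>

lemma set_borel_measurable_continuous_on_atLeast:
  fixes g :: "real \<Rightarrow> real"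
  assumes "continuous_on {a..} g"
  shows "set_borel_measurable borel {a..} g"
  using borel_measurable_continuous_on_indicator[OF _ assms]
  by (simp add: set_borel_measurable_def)

text \<open>Dominated convergence with majorant \<open>W\<close>. Since the grid samples to the left
  of \<open>l\<close>, \<open>W l\<close> must bound \<open>g\<close> on the whole of [0, max l 0].
  A constant serves for bounded \<open>g\<close>, and the value of \<open>g\<close> at
  \<open>max l 0\<close> for increasing \<open>g\<close>.\<close>

lemma has_spectral_integral_grid:
  fixes E :: "real \<Rightarrow> 'h::{real_inner, banach} \<Rightarrow> 'h"
  assumes E: "spectral_family E" and g: "continuous_on {0..} g"
    and W: "W \<in> borel_measurable borel" "(\<integral>\<^sup>+l. ennreal ((W l)\<^sup>2) \<partial>spectral_measure E x) < \<infinity>"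
    and bound: "\<And>l a. 0 \<le> a \<Longrightarrow> a \<le> max l 0 \<Longrightarrow> \<bar>g a\<bar> \<le> W l"
  obtains y where "(\<lambda>n. step_integral E (grid g n) x) \<longlonglongrightarrow> y" "has_spectral_integral E {0..} g x y"
proof -
  note [simp, measurable_cong] = sets_spectral_measure[OF E]
  note W(1)[measurable]
  have meas: "set_borel_measurable borel {0..} g"
    by (rule set_borel_measurable_continuous_on_atLeast[OF g])
  let ?M = "spectral_measure E x"
  have W0: "W l \<ge> 0" for l
    using bound[of 0 l] abs_ge_zero[of "g 0"] by linarith
  have "(\<lambda>n. \<integral>\<^sup>+l. ennreal ((indicator {0..} l * g l - step_fun (grid g n) l)\<^sup>2) \<partial>?M)
      \<longlonglongrightarrow> (\<integral>\<^sup>+l. 0 \<partial>?M)"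
  \<comment> \<open>The integrand and its approximant are each at most \<open>W\<close> in absolute
    value, whence the constant 4.\<close>
  proof (rule nn_integral_dominated_convergence[where w = "\<lambda>l. 4 * ennreal ((W l)\<^sup>2)"])
    show "AE l in ?M. ennreal ((indicator {0..} l * g l - step_fun (grid g n) l)\<^sup>2) \<le> 4 * ennreal ((W l)\<^sup>2)" for n
    proof (rule AE_I2)
      fix l
      have "\<bar>indicator {0..} l * g l\<bar> \<le> W l"
        using W0[of l] bound[of l l] by (auto simp: indicator_def)
      moreover have "\<bar>step_fun (grid g n) l\<bar> \<le> W l"
        using step_fun_grid_cases[of g n l] W0[of l] bound[of _ l] by auto
      ultimately have "\<bar>indicator {0..} l * g l - step_fun (grid g n) l\<bar> \<le> 2 * W l"
        by linarith
      then have "(indicator {0..} l * g l - step_fun (grid g n) l)\<^sup>2 \<le> (2 * W l)\<^sup>2"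
        by (metis abs_ge_zero power_mono power2_abs)
      then have "ennreal ((indicator {0..} l * g l - step_fun (grid g n) l)\<^sup>2) \<le> ennreal (4 * (W l)\<^sup>2)"
        by (intro ennreal_leI) (simp add: power_mult_distrib)
      then show "ennreal ((indicator {0..} l * g l - step_fun (grid g n) l)\<^sup>2) \<le> 4 * ennreal ((W l)\<^sup>2)"
        by (simp add: ennreal_mult)
    qed
    show "AE l in ?M. (\<lambda>n. ennreal ((indicator {0..} l * g l - step_fun (grid g n) l)\<^sup>2)) \<longlonglongrightarrow> 0"
    proof (rule AE_I2)
      fix l
      have "(\<lambda>n. ennreal ((indicator {0..} l * g l - step_fun (grid g n) l)\<^sup>2))
          \<longlonglongrightarrow> ennreal ((indicator {0..} l * g l - indicator {0..} l * g l)\<^sup>2)"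
        by (intro tendsto_intros step_fun_grid_tendsto g)
      then show "(\<lambda>n. ennreal ((indicator {0..} l * g l - step_fun (grid g n) l)\<^sup>2)) \<longlonglongrightarrow> 0"
        by simp
    qed
    show "(\<integral>\<^sup>+l. 4 * ennreal ((W l)\<^sup>2) \<partial>?M) < \<infinity>"
      using W(2) by (simp add: nn_integral_cmult ennreal_mult_less_top)
    show "(\<lambda>l. ennreal ((indicator {0..} l * g l - step_fun (grid g n) l)\<^sup>2)) \<in> borel_measurable ?M" for n
      by (intro measurable_compose[OF _ measurable_ennreal] borel_measurable_power
          borel_measurable_minus_step_fun[OF E] meas)
  qed measurable
  then have "(\<lambda>n. \<integral>\<^sup>+l. ennreal ((indicator {0..} l * g l - step_fun (grid g n) l)\<^sup>2) \<partial>?M) \<longlonglongrightarrow> 0"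
    by simp
  then show ?thesis
    by (rule has_spectral_integral_of_approx[OF E meas valid_grid]) (rule that)
qed

section \<open>Functions of the operator\<close>

lemma spectral_projection_pythagoras:
  assumes "spectral_family E"
  shows "(norm (x - E l x))\<^sup>2 = (norm x)\<^sup>2 - (norm (E l x))\<^sup>2"
proof -
  have "x \<bullet> E l x = E l x \<bullet> E l x"
    using spectral_projection[OF assms, of l] unfolding orthogonal_projection_def by metis
  then show ?thesis
    by (simp add: power2_norm_eq_inner inner_diff_left inner_diff_right inner_commute)
qed

context
  fixes E :: "real \<Rightarrow> 'h::{real_inner, banach} \<Rightarrow> 'h"
  assumes E: "spectral_family E"
begin

lemmas [simp, measurable_cong] = sets_spectral_measure[OF E]
lemmas [simp] = space_spectral_measure[OF E]

lemma has_spectral_integral_bounded_grid: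
  assumes g: "continuous_on {0..} g" and K: "\<And>l. l \<ge> 0 \<Longrightarrow> \<bar>g l\<bar> \<le> K"
  obtains y where "(\<lambda>n. step_integral E (grid g n) x) \<longlonglongrightarrow> y" "has_spectral_integral E {0..} g x y"
proof (rule has_spectral_integral_grid[OF E g, of "\<lambda>_. K"])
  show "(\<integral>\<^sup>+l. ennreal (K\<^sup>2) \<partial>spectral_measure E x) < \<infinity>"
    by (simp add: emeasure_spectral_measure_UNIV[OF E] ennreal_mult_less_top)
  show "\<bar>g a\<bar> \<le> K" if "0 \<le> a" for a
    by (rule K[OF that])
qed (use that in auto)

lemma has_spectral_integral_bounded:
  assumes "continuous_on {0..} g" "\<And>l. l \<ge> 0 \<Longrightarrow> \<bar>g l\<bar> \<le> K"
  shows "has_spectral_integral E {0..} g x (fun_op E g x)"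
proof -
  obtain y where "has_spectral_integral E {0..} g x y"
    using has_spectral_integral_bounded_grid[OF assms] by blast
  then show ?thesis
    by (simp add: fun_op_def spectral_integral_eqI[OF E])
qed

text \<open>The grid approximations do not depend on the vector, so the limit inherits their linearity.\<close>

lemma fun_op_lipschitz:
  assumes g: "continuous_on {0..} g" and K: "\<And>l. l \<ge> 0 \<Longrightarrow> \<bar>g l\<bar> \<le> K"
  shows "norm (fun_op E g x - fun_op E g x') \<le> K * norm (x - x')"
proof -
  have K0: "K \<ge> 0"
    using K[of 0] by linarith
  obtain y where y: "(\<lambda>n. step_integral E (grid g n) x) \<longlonglongrightarrow> y" "has_spectral_integral E {0..} g x y"
    using has_spectral_integral_bounded_grid[OF g K] by blast
  obtain y' where y': "(\<lambda>n. step_integral E (grid g n) x') \<longlonglongrightarrow> y'" "has_spectral_integral E {0..} g x' y'"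
    using has_spectral_integral_bounded_grid[OF g K] by blast
  obtain z where z: "(\<lambda>n. step_integral E (grid g n) (x - x')) \<longlonglongrightarrow> z"
    "has_spectral_integral E {0..} g (x - x') z"
    using has_spectral_integral_bounded_grid[OF g K] by blast
  have "(\<lambda>n. step_integral E (grid g n) (x - x')) \<longlonglongrightarrow> y - y'"
    using tendsto_diff[OF y(1) y'(1)] by (simp add: linear_diff[OF step_integral_linear[OF E]])
  then have zy: "z = y - y'"
    using z(1) LIMSEQ_unique by blast
  have "ennreal ((norm z)\<^sup>2) =
      (\<integral>\<^sup>+l. ennreal ((indicator {0..} l * g l)\<^sup>2) \<partial>spectral_measure E (x - x'))"
    by (rule has_spectral_integral_isometry[OF E z(2), symmetric])
  also have "\<dots> \<le> (\<integral>\<^sup>+l. ennreal (K\<^sup>2) \<partial>spectral_measure E (x - x'))"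
  proof (intro nn_integral_mono ennreal_leI)
    fix l :: real
    show "(indicator {0..} l * g l)\<^sup>2 \<le> K\<^sup>2"
      using K[of l] K0 by (auto simp: indicator_def abs_le_square_iff[symmetric])
  qed
  also have "\<dots> = ennreal ((K * norm (x - x'))\<^sup>2)"
    by (simp add: emeasure_spectral_measure_UNIV[OF E] ennreal_mult power_mult_distrib)
  finally have "(norm z)\<^sup>2 \<le> (K * norm (x - x'))\<^sup>2"
    by simp
  then have "norm z \<le> K * norm (x - x')"
    by (rule power2_le_imp_le) (simp add: K0)
  then show ?thesis
    using y(2) y'(2) by (simp add: fun_op_def spectral_integral_eqI[OF E] zy)
qed

text \<open>Monotonicity makes \<open>g\<close> its own majorant on the interval to the left of each
  point, so the square integrability contained in \<open>fun_dom\<close> is enough for the grid to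
  converge.\<close>

lemma has_spectral_integral_fun_dom:
  assumes g: "continuous_on {0..} g" and pos: "\<And>l. l \<ge> 0 \<Longrightarrow> 0 \<le> g l" and mono: "mono_on {0..} g"
    and x: "x \<in> fun_dom E g"
  shows "has_spectral_integral E {0..} g x (fun_op E g x)"
proof -
  let ?W = "\<lambda>l. g (max l 0)"
  have "continuous_on UNIV ?W"
    by (intro continuous_on_compose2[OF g] continuous_intros) auto
  then have W [measurable]: "?W \<in> borel_measurable borel"
    by (rule borel_measurable_continuous_onI)
  have "integrable (spectral_measure E x) (\<lambda>l. indicator {0..} l * (g l)\<^sup>2)"
    using x by (simp add: fun_dom_def set_integrable_def)
  then have fin: "(\<integral>\<^sup>+l. ennreal (indicator {0..} l * (g l)\<^sup>2) \<partial>spectral_measure E x) < \<infinity>"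
    by (simp add: integrable_iff_bounded)
  have meas: "(\<lambda>l. ennreal (indicator {0..} l * (g l)\<^sup>2)) \<in> borel_measurable (spectral_measure E x)"
    using \<open>integrable _ _\<close> by measurable
  \<comment> \<open>\<open>fun_dom\<close> controls the half-line from 0 only. To its left
    \<open>?W\<close> is the constant \<open>g 0\<close>, which is integrable because the spectral
    measure has finite mass.\<close>
  have "(\<integral>\<^sup>+l. ennreal ((?W l)\<^sup>2) \<partial>spectral_measure E x) \<le>
      (\<integral>\<^sup>+l. ennreal (indicator {0..} l * (g l)\<^sup>2) + ennreal ((g 0)\<^sup>2) \<partial>spectral_measure E x)"
    by (intro nn_integral_mono) (auto simp: indicator_def max_def)
  also have "\<dots> < \<infinity>"
    using fin by (simp add: nn_integral_add[OF meas] emeasure_spectral_measure_UNIV[OF E] ennreal_mult_less_top)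
  finally obtain y where "has_spectral_integral E {0..} g x y"
  proof (rule has_spectral_integral_grid[OF E g W])
    show "\<bar>g a\<bar> \<le> g (max l 0)" if "0 \<le> a" "a \<le> max l 0" for l a
      using pos[OF that(1)] monotone_onD[OF mono, of a "max l 0"] that by auto
  qed
  then show ?thesis
    by (simp add: fun_op_def spectral_integral_eqI[OF E])
qed

section \<open>Exponentials of the operator and their truncation\<close>

lemma fun_dom_exp_mono:
  assumes "c \<le> d" "x \<in> fun_dom E (\<lambda>l. exp (d * l))"
  shows "x \<in> fun_dom E (\<lambda>l. exp (c * l))"
  using assms(2) unfolding fun_dom_def set_integrable_def mem_Collect_eq
  by (rule Bochner_Integration.integrable_bound)
     (auto simp: indicator_def mult_right_mono[OF assms(1)] intro!: power_mono)

text \<open>An integral over [0, \<beta>] sees \<open>h\<close> only there. Replacing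
  \<open>h\<close> by a bounded continuous \<open>g\<close> gives an integral over the half-line
  that exists for every vector, and cutting it at \<beta> is the projection.\<close>

lemma truncated_integral_eq:
  assumes "continuous_on {0..} g" "\<And>l. l \<ge> 0 \<Longrightarrow> \<bar>g l\<bar> \<le> K" "\<And>l. 0 \<le> l \<Longrightarrow> l \<le> \<beta> \<Longrightarrow> g l = h l"
  shows "spectral_integral E {0..\<beta>} h x = E \<beta> (fun_op E g x)"
proof (rule spectral_integral_eqI[OF E])
  have "has_spectral_integral E ({0..} \<inter> {..\<beta>}) g x (E \<beta> (fun_op E g x))"
    by (intro has_spectral_integral_cut[OF E] has_spectral_integral_bounded[OF assms(1,2)])
  then show "has_spectral_integral E {0..\<beta>} h x (E \<beta> (fun_op E g x))"
    by (subst has_spectral_integral_cong[where T = "{0..} \<inter> {..\<beta>}" and h = g])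
       (auto simp: indicator_def assms(3))
qed

lemma truncated_exp_lipschitz:
  assumes "c \<ge> 0" "\<beta> > 0"
  shows "norm (spectral_integral E {0..\<beta>} (\<lambda>l. exp (c * l)) x - spectral_integral E {0..\<beta>} (\<lambda>l. exp (c * l)) x')
     \<le> exp (c * \<beta>) * norm (x - x')"
proof -
  \<comment> \<open>The exponent is frozen at \<beta>. The resulting bound
    \<open>exp (c * \<beta>)\<close> is the amplification factor of the stability estimate.\<close>
  let ?g = "\<lambda>l. exp (c * min l \<beta>)"
  have g: "continuous_on {0..} ?g"
    by (intro continuous_intros)
  have K: "\<bar>?g l\<bar> \<le> exp (c * \<beta>)" for l
    using assms by (simp add: mult_left_mono)
  have eq: "spectral_integral E {0..\<beta>} (\<lambda>l. exp (c * l)) z = E \<beta> (fun_op E ?g z)" for z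
    by (rule truncated_integral_eq[OF g K]) auto
  have "norm (E \<beta> (fun_op E ?g x - fun_op E ?g x')) \<le> norm (fun_op E ?g x - fun_op E ?g x')"
    by (rule orthogonal_projection_norm_le[OF spectral_projection[OF E]])
  also have "\<dots> \<le> exp (c * \<beta>) * norm (x - x')"
    by (rule fun_op_lipschitz[OF g K])
  finally show ?thesis
    by (simp add: eq linear_diff[OF linear_spectral_projection[OF E]])
qed

lemma truncated_exp_eq:
  assumes "c \<ge> 0" "x \<in> fun_dom E (\<lambda>l. exp (c * l))"
  shows "spectral_integral E {0..\<beta>} (\<lambda>l. exp (c * l)) x = E \<beta> (fun_op E (\<lambda>l. exp (c * l)) x)"
proof (rule spectral_integral_eqI[OF E])
  have "has_spectral_integral E ({0..} \<inter> {..\<beta>}) (\<lambda>l. exp (c * l)) x (E \<beta> (fun_op E (\<lambda>l. exp (c * l)) x))"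
    using assms
    by (intro has_spectral_integral_cut[OF E] has_spectral_integral_fun_dom continuous_intros mono_onI)
       (auto intro: mult_left_mono)
  then show "has_spectral_integral E {0..\<beta>} (\<lambda>l. exp (c * l)) x (E \<beta> (fun_op E (\<lambda>l. exp (c * l)) x))"
    by (subst has_spectral_integral_cong[where T = "{0..} \<inter> {..\<beta>}" and h = "\<lambda>l. exp (c * l)"])
       (auto simp: indicator_def)
qed

lemma exp_decay_le_one: "c \<ge> 0 \<Longrightarrow> l \<ge> 0 \<Longrightarrow> \<bar>exp (- c * l)\<bar> \<le> (1::real)"
  by simp

lemma fun_op_exp_contraction:
  assumes "c \<ge> 0"
  shows "norm (fun_op E (\<lambda>l. exp (- c * l)) x - fun_op E (\<lambda>l. exp (- c * l)) x') \<le> norm (x - x')"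
proof -
  have "norm (fun_op E (\<lambda>l. exp (- c * l)) x - fun_op E (\<lambda>l. exp (- c * l)) x') \<le> 1 * norm (x - x')"
    by (rule fun_op_lipschitz[OF _ exp_decay_le_one[OF assms]]) (intro continuous_intros)
  then show ?thesis by simp
qed

text \<open>The spectral measure of 0 has no mass. Combined with the contraction property, this
  bounds the image of a vector by the norm of the vector.\<close>

lemma fun_op_exp_zero:
  assumes "c \<ge> 0"
  shows "fun_op E (\<lambda>l. exp (- c * l)) 0 = 0"
proof -
  have "continuous_on {0..} (\<lambda>l. exp (- c * l))"
    by (intro continuous_intros)
  from has_spectral_integral_isometry[OF E has_spectral_integral_bounded[OF this exp_decay_le_one[OF assms]], of 0]
  have "ennreal ((norm (fun_op E (\<lambda>l. exp (- c * l)) 0))\<^sup>2) =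
      (\<integral>\<^sup>+l. ennreal ((indicator {0..} l * exp (- c * l))\<^sup>2) \<partial>spectral_measure E 0)"
    by (rule sym)
  also have "\<dots> \<le> (\<integral>\<^sup>+l. 1 \<partial>spectral_measure E 0)"
    using exp_decay_le_one[OF assms]
    by (intro nn_integral_mono) (auto simp: indicator_def power_le_one simp flip: ennreal_1 intro!: ennreal_leI)
  also have "\<dots> = 0"
    by (simp add: emeasure_spectral_measure_UNIV[OF E])
  finally show ?thesis
    by simp
qed

text \<open>Strong continuity, which is all that can be expected at s = \<tau> for an unbounded
  operator. By the isometry it becomes dominated convergence in the finite measure of
  \<open>x\<close>; both exponentials lie in (0, 1], so their difference is dominated by 1.\<close>

lemma fun_op_exp_continuous:
  "continuous_on {..\<tau>} (\<lambda>s. fun_op E (\<lambda>l. exp (- (\<tau> - s) * l)) x)"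
  unfolding continuous_on_sequentially comp_def
proof (intro allI ballI impI)
  fix r :: "nat \<Rightarrow> real" and s :: real
  assume s: "s \<in> {..\<tau>}" and "(\<forall>n. r n \<in> {..\<tau>}) \<and> r \<longlonglongrightarrow> s"
  then have r: "\<And>n. r n \<le> \<tau>" "r \<longlonglongrightarrow> s" by auto
  let ?M = "spectral_measure E x"
  define T where "T s = fun_op E (\<lambda>l. exp (- (\<tau> - s) * l)) x" for s
  have has: "has_spectral_integral E {0..} (\<lambda>l. exp (- (\<tau> - s) * l)) x (T s)" if "s \<le> \<tau>" for s
    unfolding T_def
    by (rule has_spectral_integral_bounded[OF _ exp_decay_le_one]) (use that in \<open>auto intro!: continuous_intros\<close>)
  have iso: "ennreal ((norm (T (r n) - T s))\<^sup>2) =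
      (\<integral>\<^sup>+l. ennreal ((indicator {0..} l * (exp (- (\<tau> - r n) * l) - exp (- (\<tau> - s) * l)))\<^sup>2) \<partial>?M)" for n
    using s r(1) by (intro has_spectral_integral_isometry[OF E, symmetric] has_spectral_integral_diff[OF E] has) auto
  have "(\<lambda>n. \<integral>\<^sup>+l. ennreal ((indicator {0..} l * (exp (- (\<tau> - r n) * l) - exp (- (\<tau> - s) * l)))\<^sup>2) \<partial>?M)
      \<longlonglongrightarrow> (\<integral>\<^sup>+l. 0 \<partial>?M)"
  proof (rule nn_integral_dominated_convergence[where w = "\<lambda>_. 1"])
    show "AE l in ?M. ennreal ((indicator {0..} l * (exp (- (\<tau> - r n) * l) - exp (- (\<tau> - s) * l)))\<^sup>2) \<le> 1" for n
    proof (rule AE_I2)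
      fix l :: real
      have "\<bar>exp (- (\<tau> - r n) * l) - exp (- (\<tau> - s) * l)\<bar> \<le> 1" if "l \<ge> 0"
        using exp_decay_le_one[OF _ that, of "\<tau> - r n"] exp_decay_le_one[OF _ that, of "\<tau> - s"]
          exp_gt_zero[of "- (\<tau> - r n) * l"] exp_gt_zero[of "- (\<tau> - s) * l"] r(1)[of n] s
        unfolding atMost_iff by linarith
      then have "\<bar>indicator {0..} l * (exp (- (\<tau> - r n) * l) - exp (- (\<tau> - s) * l))\<bar> \<le> 1"
        by (auto simp: indicator_def)
      then have "(indicator {0..} l * (exp (- (\<tau> - r n) * l) - exp (- (\<tau> - s) * l)))\<^sup>2 \<le> 1"
        by (simp only: abs_square_le_1)
      then show "ennreal ((indicator {0..} l * (exp (- (\<tau> - r n) * l) - exp (- (\<tau> - s) * l)))\<^sup>2) \<le> 1"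
        by (metis ennreal_1 ennreal_leI)
    qed
    show "AE l in ?M. (\<lambda>n. ennreal ((indicator {0..} l * (exp (- (\<tau> - r n) * l) - exp (- (\<tau> - s) * l)))\<^sup>2)) \<longlonglongrightarrow> 0"
    proof (rule AE_I2)
      fix l
      have "(\<lambda>n. ennreal ((indicator {0..} l * (exp (- (\<tau> - r n) * l) - exp (- (\<tau> - s) * l)))\<^sup>2))
          \<longlonglongrightarrow> ennreal ((indicator {0..} l * (exp (- (\<tau> - s) * l) - exp (- (\<tau> - s) * l)))\<^sup>2)"
        by (intro tendsto_intros r)
      then show "(\<lambda>n. ennreal ((indicator {0..} l * (exp (- (\<tau> - r n) * l) - exp (- (\<tau> - s) * l)))\<^sup>2)) \<longlonglongrightarrow> 0"
        by simp
    qed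
    show "(\<integral>\<^sup>+l. 1 \<partial>?M) < \<infinity>"
      by (simp add: emeasure_spectral_measure_UNIV[OF E])
  qed measurable
  then have "(\<lambda>n. ennreal ((norm (T (r n) - T s))\<^sup>2)) \<longlonglongrightarrow> ennreal 0"
    by (simp add: iso)
  then have "(\<lambda>n. (norm (T (r n) - T s))\<^sup>2) \<longlonglongrightarrow> 0"
    by (subst (asm) tendsto_ennreal_iff) auto
  then have "(\<lambda>n. sqrt ((norm (T (r n) - T s))\<^sup>2)) \<longlonglongrightarrow> sqrt 0"
    by (rule tendsto_real_sqrt)
  then have "(\<lambda>n. norm (T (r n) - T s)) \<longlonglongrightarrow> 0"
    by simp
  then have "(\<lambda>n. T (r n)) \<longlonglongrightarrow> T s"
    by (simp only: tendsto_norm_zero_iff LIM_zero_iff)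
  then show "(\<lambda>n. fun_op E (\<lambda>l. exp (- (\<tau> - r n) * l)) x) \<longlonglongrightarrow> fun_op E (\<lambda>l. exp (- (\<tau> - s) * l)) x"
    by (simp add: T_def)
qed

text \<open>The integral of the square of \<open>h\<close> against the measure of \<open>u\<close>
  splits at \<beta>. The part up to \<beta> is the squared norm of \<open>E \<beta>\<close> applied
  to \<open>fun_op E h u\<close>; beyond \<beta>, \<open>h\<close> is at least
  \<open>h \<beta>\<close> and the mass is the squared norm of \<open>u - E \<beta> u\<close>.
  Pythagoras then identifies what is left for the second part.\<close>

lemma spectral_tail_bound:
  assumes h: "continuous_on {0..} h" and mono: "mono_on {0..} h" and pos: "\<And>l. l \<ge> 0 \<Longrightarrow> h l > 0"
    and u: "u \<in> fun_dom E h" and \<beta>: "\<beta> \<ge> 0"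
  shows "norm (u - E \<beta> u) \<le> norm (fun_op E h u - E \<beta> (fun_op E h u)) / h \<beta>"
proof -
  let ?M = "spectral_measure E u" and ?w = "fun_op E h u"
  have hb: "h \<beta> > 0"
    using pos \<beta> by simp
  have w: "has_spectral_integral E {0..} h u ?w"
    by (rule has_spectral_integral_fun_dom[OF h less_imp_le[OF pos] mono u])
  have "emeasure ?M {\<beta><..} = emeasure ?M (UNIV - {..\<beta>})"
    by (intro arg_cong2[where f = emeasure]) auto
  also have "\<dots> = emeasure ?M UNIV - emeasure ?M {..\<beta>}"
    by (rule emeasure_Diff) (auto simp: emeasure_spectral_measure_Iic[OF E])
  also have "\<dots> = ennreal ((norm (u - E \<beta> u))\<^sup>2)"
    by (simp add: emeasure_spectral_measure_Iic[OF E] emeasure_spectral_measure_UNIV[OF E]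
        spectral_projection_pythagoras[OF E] ennreal_minus)
  finally have tail: "emeasure ?M {\<beta><..} = ennreal ((norm (u - E \<beta> u))\<^sup>2)" .
  let ?k = "\<lambda>l. indicator ({0..} \<inter> {..\<beta>}) l * h l"
  \<comment> \<open>The two parts are added on the left, which postpones the subtraction until the
    inequality has been transferred to the reals.\<close>
  have "ennreal ((norm (E \<beta> ?w))\<^sup>2 + (h \<beta>)\<^sup>2 * (norm (u - E \<beta> u))\<^sup>2) =
      (\<integral>\<^sup>+l. ennreal ((?k l)\<^sup>2) \<partial>?M) + ennreal ((h \<beta>)\<^sup>2) * emeasure ?M {\<beta><..}"
    by (simp add: has_spectral_integral_isometry[OF E has_spectral_integral_cut[OF E w]] tail
        ennreal_mult ennreal_plus)
  also have "\<dots> = (\<integral>\<^sup>+l. ennreal ((?k l)\<^sup>2) + ennreal ((h \<beta>)\<^sup>2) * indicator {\<beta><..} l \<partial>?M)"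
    by (subst nn_integral_add)
       (auto simp: nn_integral_cmult_indicator intro!: measurable_compose[OF _ measurable_ennreal]
         borel_measurable_power borel_measurable_minus_step_fun(1)[OF E]
         has_spectral_integralD_measurable[OF has_spectral_integral_cut[OF E w]])
  also have "\<dots> \<le> (\<integral>\<^sup>+l. ennreal ((indicator {0..} l * h l)\<^sup>2) \<partial>?M)"
  proof (intro nn_integral_mono)
    fix l
    have "(h \<beta>)\<^sup>2 \<le> (h l)\<^sup>2" if "\<beta> < l"
      using that \<beta> hb by (intro power_mono monotone_onD[OF mono]) auto
    then show "ennreal ((?k l)\<^sup>2) + ennreal ((h \<beta>)\<^sup>2) * indicator {\<beta><..} l \<le> ennreal ((indicator {0..} l * h l)\<^sup>2)"
      using \<beta> by (auto simp: indicator_def intro: ennreal_leI)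
  qed
  also have "\<dots> = ennreal ((norm ?w)\<^sup>2)"
    by (rule has_spectral_integral_isometry[OF E w])
  finally have "(norm (E \<beta> ?w))\<^sup>2 + (h \<beta>)\<^sup>2 * (norm (u - E \<beta> u))\<^sup>2 \<le> (norm ?w)\<^sup>2"
    by (subst (asm) ennreal_le_iff) auto
  then have "(h \<beta> * norm (u - E \<beta> u))\<^sup>2 \<le> (norm (?w - E \<beta> ?w))\<^sup>2"
    by (simp add: spectral_projection_pythagoras[OF E, of ?w] power_mult_distrib)
  then have "h \<beta> * norm (u - E \<beta> u) \<le> norm (?w - E \<beta> ?w)"
    by (rule power2_le_imp_le) simp
  then show ?thesis
    using hb by (simp add: pos_le_divide_eq mult.commute)
qed

end

section \<open>Bochner integrals in nonseparable spaces\<close>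

text \<open>Limits of simple functions have essentially separable range, which replaces separability of
  the space: their differences are measurable again.\<close>

definition strongly_measurable :: "'a measure \<Rightarrow> ('a \<Rightarrow> 'b::real_normed_vector) \<Rightarrow> bool" where
  "strongly_measurable M f \<longleftrightarrow>
     (\<exists>s. (\<forall>i. simple_function M (s i)) \<and> (AE x in M. (\<lambda>i. s i x) \<longlonglongrightarrow> f x))"

text \<open>Set to 0 on a null set, the simple functions converge everywhere, and pointwise limits
  in a metric space are Borel. Restoring the values on the null set changes preimages by subsets of
  it, which are measurable by completeness.\<close>

lemma strongly_measurable_imp_borel_measurable:
  assumes M: "complete_measure M" and f: "strongly_measurable M f"
  shows "f \<in> borel_measurable M"
proof -
  obtain s where s: "\<And>i. simple_function M (s i)" and lim: "AE x in M. (\<lambda>i. s i x) \<longlonglongrightarrow> f x"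
    using f unfolding strongly_measurable_def by blast
  obtain N where N: "{x \<in> space M. \<not> (\<lambda>i. s i x) \<longlonglongrightarrow> f x} \<subseteq> N" "N \<in> null_sets M"
    using AE_E[OF lim] by (metis null_setsI)
  define g where "g x = (if x \<in> N then 0 else f x)" for x
  have N_sets: "N \<in> sets M"
    using N(2) by (rule null_setsD2)
  have g: "g \<in> borel_measurable M"
  proof (rule borel_measurable_LIMSEQ_metric)
    show "(\<lambda>x. if x \<in> N then 0 else s i x) \<in> borel_measurable M" for i
      using N_sets borel_measurable_simple_function[OF s]
      by (intro measurable_If_set borel_measurable_const) (auto simp: sets.Int_space_eq2)
    show "(\<lambda>i. if x \<in> N then 0 else s i x) \<longlonglongrightarrow> g x" if "x \<in> space M" for x
      using N(1) that by (auto simp: g_def)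
  qed
  show ?thesis
  proof (rule measurableI)
    fix A :: "'b set" assume A: "A \<in> sets borel"
    have eq: "f -` A \<inter> space M = (g -` A \<inter> space M - N) \<union> (f -` A \<inter> space M \<inter> N)"
      by (auto simp: g_def)
    have "f -` A \<inter> space M \<inter> N \<in> sets M"
      by (rule complete_measure.complete[OF M _ N(2)]) auto
    then show "f -` A \<inter> space M \<in> sets M"
      using measurable_sets[OF g A] N_sets by (subst eq) auto
  qed simp
qed

lemma strongly_measurable_diff:
  assumes "strongly_measurable M f" "strongly_measurable M g"
  shows "strongly_measurable M (\<lambda>x. f x - g x)"
proof -
  obtain s where s: "\<And>i. simple_function M (s i)" "AE x in M. (\<lambda>i. s i x) \<longlonglongrightarrow> f x"
    using assms(1) unfolding strongly_measurable_def by blast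
  obtain r where r: "\<And>i. simple_function M (r i)" "AE x in M. (\<lambda>i. r i x) \<longlonglongrightarrow> g x"
    using assms(2) unfolding strongly_measurable_def by blast
  show ?thesis
    unfolding strongly_measurable_def
  proof (intro exI conjI allI)
    show "simple_function M (\<lambda>x. s i x - r i x)" for i
      by (rule simple_function_compose2[OF s(1) r(1), where h = "(-)"])
    show "AE x in M. (\<lambda>i. s i x - r i x) \<longlonglongrightarrow> f x - g x"
      using s(2) r(2) by eventually_elim (rule tendsto_diff)
  qed
qed

text \<open>Subtracting a simple function stays measurable without separability: on each of finitely
  many pieces only a constant is subtracted.\<close>

lemma borel_measurable_norm_diff_simple:
  fixes f :: "'a \<Rightarrow> 'b::real_normed_vector"
  assumes f: "f \<in> borel_measurable M" and s: "simple_function M s"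
  shows "(\<lambda>x. norm (f x - s x)) \<in> borel_measurable M"
proof (rule measurable_compose_countable'[where I = "s ` space M" and f = "\<lambda>i x. norm (f x - i)"])
  show "(\<lambda>x. norm (f x - i)) \<in> borel_measurable M" for i
    by (rule measurable_compose[OF f], rule borel_measurable_continuous_onI) (intro continuous_intros)
  show "s \<in> M \<rightarrow>\<^sub>M count_space (s ` space M)"
    using s by (auto simp: simple_function_def measurable_count_space_eq2)
  show "countable (s ` space M)"
    using s by (auto simp: simple_function_def countable_finite)
qed

text \<open>One triangle inequality with several uses: with \<open>g = f\<close> it gives the Cauchy
  property of the approximants, and in the limit it gives uniqueness and the norm estimate of the
  integral. Measurability of the norm of \<open>f - g\<close> is a premise since it does not follow
  from that of \<open>f\<close> and \<open>g\<close> separately.\<close>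

lemma simple_bochner_integral_diff_le:
  fixes f g :: "'a \<Rightarrow> 'b::real_normed_vector"
  assumes f: "f \<in> borel_measurable M" and g: "g \<in> borel_measurable M"
    and fg [measurable]: "(\<lambda>x. norm (f x - g x)) \<in> borel_measurable M"
    and s: "Bochner_Integration.simple_bochner_integrable M s"
    and t: "Bochner_Integration.simple_bochner_integrable M t"
  shows "ennreal (norm (Bochner_Integration.simple_bochner_integral M s
        - Bochner_Integration.simple_bochner_integral M t)) \<le>
    (\<integral>\<^sup>+x. norm (f x - s x) \<partial>M) + (\<integral>\<^sup>+x. norm (f x - g x) \<partial>M) + (\<integral>\<^sup>+x. norm (g x - t x) \<partial>M)"
proof -
  have [measurable]: "(\<lambda>x. norm (f x - s x)) \<in> borel_measurable M" "(\<lambda>x. norm (g x - t x)) \<in> borel_measurable M"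
    using s t f g
    by (auto intro: borel_measurable_norm_diff_simple elim: Bochner_Integration.simple_bochner_integrable.cases)
  have "norm (Bochner_Integration.simple_bochner_integral M s - Bochner_Integration.simple_bochner_integral M t)
      = norm (Bochner_Integration.simple_bochner_integral M (\<lambda>x. s x - t x))"
    using s t by (subst Bochner_Integration.simple_bochner_integral_diff) auto
  also have "\<dots> \<le> Bochner_Integration.simple_bochner_integral M (\<lambda>x. norm (s x - t x))"
    using Bochner_Integration.simple_bochner_integrable_compose2[of "(-)" M s t] s t
    by (auto intro!: Bochner_Integration.simple_bochner_integral_norm_bound)
  finally have "ennreal (norm (Bochner_Integration.simple_bochner_integral M s
        - Bochner_Integration.simple_bochner_integral M t)) \<le>
      ennreal (Bochner_Integration.simple_bochner_integral M (\<lambda>x. norm (s x - t x)))"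
    by (rule ennreal_leI)
  also have "\<dots> = (\<integral>\<^sup>+x. norm (s x - t x) \<partial>M)"
    using Bochner_Integration.simple_bochner_integrable_compose2[of "\<lambda>x y. norm (x - y)" M s t] s t
    by (auto intro!: Bochner_Integration.simple_bochner_integral_eq_nn_integral)
  also have "\<dots> \<le> (\<integral>\<^sup>+x. ennreal (norm (f x - s x)) + ennreal (norm (f x - g x)) + ennreal (norm (g x - t x)) \<partial>M)"
  proof (rule nn_integral_mono)
    fix x
    have "s x - t x = (g x - t x) + (f x - g x) - (f x - s x)"
      by simp
    then have "norm (s x - t x) \<le> norm (f x - s x) + norm (f x - g x) + norm (g x - t x)"
      by (smt (verit) norm_triangle_ineq norm_triangle_ineq4)
    then show "ennreal (norm (s x - t x)) \<le>
        ennreal (norm (f x - s x)) + ennreal (norm (f x - g x)) + ennreal (norm (g x - t x))"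
      by (simp flip: ennreal_plus)
  qed
  also have "\<dots> = (\<integral>\<^sup>+x. norm (f x - s x) \<partial>M) + (\<integral>\<^sup>+x. norm (f x - g x) \<partial>M) + (\<integral>\<^sup>+x. norm (g x - t x) \<partial>M)"
    by (simp add: nn_integral_add)
  finally show ?thesis .
qed

lemma has_bochner_diff_le:
  assumes f: "has_bochner M f y" and g: "has_bochner M g z"
    and fg: "(\<lambda>x. norm (f x - g x)) \<in> borel_measurable M"
  shows "ennreal (norm (y - z)) \<le> (\<integral>\<^sup>+x. norm (f x - g x) \<partial>M)"
proof -
  obtain s where s: "f \<in> borel_measurable M"
    "\<And>i. Bochner_Integration.simple_bochner_integrable M (s i)"
    "(\<lambda>i. \<integral>\<^sup>+x. ennreal (norm (f x - s i x)) \<partial>M) \<longlonglongrightarrow> 0"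
    "(\<lambda>i. Bochner_Integration.simple_bochner_integral M (s i)) \<longlonglongrightarrow> y"
    using f unfolding has_bochner_def by blast
  obtain t where t: "g \<in> borel_measurable M"
    "\<And>i. Bochner_Integration.simple_bochner_integrable M (t i)"
    "(\<lambda>i. \<integral>\<^sup>+x. ennreal (norm (g x - t i x)) \<partial>M) \<longlonglongrightarrow> 0"
    "(\<lambda>i. Bochner_Integration.simple_bochner_integral M (t i)) \<longlonglongrightarrow> z"
    using g unfolding has_bochner_def by blast
  show ?thesis
  proof (rule tendsto_le[OF sequentially_bot])
    show "(\<lambda>i. ennreal (norm (Bochner_Integration.simple_bochner_integral M (s i)
        - Bochner_Integration.simple_bochner_integral M (t i)))) \<longlonglongrightarrow> ennreal (norm (y - z))"
      by (intro tendsto_intros s t)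
    have "(\<lambda>i. (\<integral>\<^sup>+x. norm (f x - s i x) \<partial>M) + (\<integral>\<^sup>+x. norm (f x - g x) \<partial>M) + (\<integral>\<^sup>+x. norm (g x - t i x) \<partial>M))
        \<longlonglongrightarrow> 0 + (\<integral>\<^sup>+x. norm (f x - g x) \<partial>M) + 0"
      by (intro tendsto_add tendsto_const s t)
    then show "(\<lambda>i. (\<integral>\<^sup>+x. norm (f x - s i x) \<partial>M) + (\<integral>\<^sup>+x. norm (f x - g x) \<partial>M) + (\<integral>\<^sup>+x. norm (g x - t i x) \<partial>M))
        \<longlonglongrightarrow> (\<integral>\<^sup>+x. norm (f x - g x) \<partial>M)"
      by simp
  qed (intro always_eventually allI simple_bochner_integral_diff_le s t fg)
qed

lemma bochner_eqI:
  assumes "has_bochner M f y"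
  shows "bochner M f = y"
  unfolding bochner_def
proof (rule the_equality)
  show "has_bochner M f y"
    by (rule assms)
  fix z assume "has_bochner M f z"
  \<comment> \<open>Comparing a function with itself: the right-hand side is the integral of
    0.\<close>
  from has_bochner_diff_le[OF this assms] show "z = y"
    by simp
qed

text \<open>A single approximant at finite distance suffices, because it is integrable
  itself.\<close>

lemma has_bochner_nn_integral_finite:
  assumes "has_bochner M f y"
  shows "(\<integral>\<^sup>+x. norm (f x) \<partial>M) < \<infinity>"
proof -
  obtain s where s: "f \<in> borel_measurable M"
    "\<And>i. Bochner_Integration.simple_bochner_integrable M (s i)"
    "(\<lambda>i. \<integral>\<^sup>+x. ennreal (norm (f x - s i x)) \<partial>M) \<longlonglongrightarrow> 0"
    using assms unfolding has_bochner_def by blast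
  have "eventually (\<lambda>i. (\<integral>\<^sup>+x. ennreal (norm (f x - s i x)) \<partial>M) < \<infinity>) sequentially"
    using s(3) by (rule order_tendstoD) simp
  then obtain i where i: "(\<integral>\<^sup>+x. ennreal (norm (f x - s i x)) \<partial>M) < \<infinity>"
    by (auto simp: eventually_sequentially)
  have si: "simple_function M (s i)"
    using s(2) by (auto elim: Bochner_Integration.simple_bochner_integrable.cases)
  have meas [measurable]: "(\<lambda>x. norm (f x - s i x)) \<in> borel_measurable M" "(\<lambda>x. norm (s i x)) \<in> borel_measurable M"
    by (rule borel_measurable_norm_diff_simple[OF s(1) si])
       (rule borel_measurable_simple_function[OF simple_function_compose1[OF si]])
  have "Bochner_Integration.simple_bochner_integrable M (\<lambda>x. norm (s i x))"
    using Bochner_Integration.simple_bochner_integrable_compose2[of "\<lambda>x y. norm x" M "s i" "s i"] s(2) by simp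
  then have "(\<integral>\<^sup>+x. norm (s i x) \<partial>M) = Bochner_Integration.simple_bochner_integral M (\<lambda>x. norm (s i x))"
    by (subst Bochner_Integration.simple_bochner_integral_eq_nn_integral) auto
  then have "(\<integral>\<^sup>+x. norm (s i x) \<partial>M) < \<infinity>"
    by simp
  moreover have "(\<integral>\<^sup>+x. norm (f x) \<partial>M) \<le> (\<integral>\<^sup>+x. ennreal (norm (f x - s i x)) + ennreal (norm (s i x)) \<partial>M)"
  proof (rule nn_integral_mono)
    fix x
    have "norm (f x) \<le> norm (f x - s i x) + norm (s i x)"
      using norm_triangle_ineq[of "f x - s i x" "s i x"] by simp
    then show "ennreal (norm (f x)) \<le> ennreal (norm (f x - s i x)) + ennreal (norm (s i x))"
      by (simp flip: ennreal_plus)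
  qed
  moreover have "(\<integral>\<^sup>+x. ennreal (norm (f x - s i x)) + ennreal (norm (s i x)) \<partial>M) =
      (\<integral>\<^sup>+x. ennreal (norm (f x - s i x)) \<partial>M) + (\<integral>\<^sup>+x. ennreal (norm (s i x)) \<partial>M)"
    by (rule nn_integral_add) measurable
  ultimately show ?thesis
    using i by (auto simp: less_top[symmetric] top_unique)
qed

text \<open>Convergence in mean yields a subsequence that converges almost everywhere.\<close>

lemma has_bochner_strongly_measurable:
  assumes "has_bochner M f y"
  shows "strongly_measurable M f"
proof -
  obtain s where s: "f \<in> borel_measurable M"
    "\<And>i. Bochner_Integration.simple_bochner_integrable M (s i)"
    "(\<lambda>i. \<integral>\<^sup>+x. ennreal (norm (f x - s i x)) \<partial>M) \<longlonglongrightarrow> 0"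
    using assms unfolding has_bochner_def by blast
  have sf: "simple_function M (s i)" for i
    using s(2) by (auto elim: Bochner_Integration.simple_bochner_integrable.cases)
  have "eventually (\<lambda>i. (\<integral>\<^sup>+x. ennreal (norm (f x - s i x)) \<partial>M) < \<infinity>) sequentially"
    using s(3) by (rule order_tendstoD) simp
  then obtain N where N: "\<And>i. i \<ge> N \<Longrightarrow> (\<integral>\<^sup>+x. ennreal (norm (f x - s i x)) \<partial>M) < \<infinity>"
    by (auto simp: eventually_sequentially)
  \<comment> \<open>Convergence in \<open>ennreal\<close> allows finitely many infinite distances.
    The shift by \<open>N\<close> drops them, so that every \<open>u i\<close> is integrable and
    real integrals apply.\<close>
  define u where "u i x = norm (f x - s (i + N) x)" for i x
  have meas: "u i \<in> borel_measurable M" for i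
    unfolding u_def by (rule borel_measurable_norm_diff_simple[OF s(1) sf])
  have int: "integrable M (u i)" for i
    using N[of "i + N"] by (intro integrableI_bounded meas) (simp add: u_def)
  have eq: "(\<integral>\<^sup>+x. ennreal (norm (f x - s (i + N) x)) \<partial>M) = ennreal (\<integral>x. norm (u i x) \<partial>M)" for i
    using int[of i] by (subst nn_integral_eq_integral[symmetric]) (auto simp: u_def[abs_def])
  have "(\<lambda>i. ennreal (\<integral>x. norm (u i x) \<partial>M)) \<longlonglongrightarrow> ennreal 0"
    using LIMSEQ_ignore_initial_segment[OF s(3), of N] by (simp add: eq)
  then have "(\<lambda>i. \<integral>x. norm (u i x) \<partial>M) \<longlonglongrightarrow> 0"
    by (subst (asm) tendsto_ennreal_iff) auto
  from tendsto_L1_AE_subseq[OF int this]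
  obtain r where r: "AE x in M. (\<lambda>n. u (r n) x) \<longlonglongrightarrow> 0"
    by blast
  show ?thesis
    unfolding strongly_measurable_def
  proof (intro exI conjI allI)
    show "simple_function M (s (r n + N))" for n
      by (rule sf)
    show "AE x in M. (\<lambda>n. s (r n + N) x) \<longlonglongrightarrow> f x"
      using r
    proof eventually_elim
      case (elim x)
      then have "(\<lambda>n. norm (s (r n + N) x - f x)) \<longlonglongrightarrow> 0"
        by (simp add: u_def norm_minus_commute)
      then show ?case
        by (simp only: tendsto_norm_zero_iff LIM_zero_iff)
    qed
  qed
qed

text \<open>Discarding the values with \<open>\<parallel>s n x\<parallel> > 2\<parallel>f x\<parallel>\<close> makes dominated convergence applicable.\<close>

lemma strongly_measurable_has_bochner:
  fixes f :: "'a \<Rightarrow> 'b::banach"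
  assumes M: "complete_measure M" and fin: "finite_measure M"
    and f: "strongly_measurable M f" and bound: "(\<integral>\<^sup>+x. norm (f x) \<partial>M) < \<infinity>"
  shows "\<exists>y. has_bochner M f y"
proof -
  interpret finite_measure M by fact
  have meas: "f \<in> borel_measurable M"
    by (rule strongly_measurable_imp_borel_measurable[OF M f])
  obtain s where s: "\<And>i. simple_function M (s i)" and lim: "AE x in M. (\<lambda>i. s i x) \<longlonglongrightarrow> f x"
    using f unfolding strongly_measurable_def by blast
  have nf [measurable]: "(\<lambda>x. norm (f x)) \<in> borel_measurable M"
    by (rule measurable_compose[OF meas], rule borel_measurable_continuous_onI) (intro continuous_intros)
  define r where "r i x = (if norm (s i x) \<le> 2 * norm (f x) then s i x else 0)" for i x
  have r: "simple_function M (r i)" for i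
    unfolding r_def
  proof (rule simple_function_If[OF s])
    have [measurable]: "(\<lambda>x. norm (s i x)) \<in> borel_measurable M"
      by (rule borel_measurable_simple_function[OF simple_function_compose1[OF s]])
    show "{x \<in> space M. norm (s i x) \<le> 2 * norm (f x)} \<in> sets M"
      by measurable
  qed simp
  have ri: "Bochner_Integration.simple_bochner_integrable M (r i)" for i
    by (rule Bochner_Integration.simple_bochner_integrable.intros[OF r]) simp
  have r_meas: "(\<lambda>x. norm (f x - r i x)) \<in> borel_measurable M" for i
    by (rule borel_measurable_norm_diff_simple[OF meas r])
  have "(\<lambda>i. \<integral>\<^sup>+x. ennreal (norm (f x - r i x)) \<partial>M) \<longlonglongrightarrow> (\<integral>\<^sup>+x. 0 \<partial>M)"
  proof (rule nn_integral_dominated_convergence[where w = "\<lambda>x. 3 * ennreal (norm (f x))"])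
    show "AE x in M. ennreal (norm (f x - r i x)) \<le> 3 * ennreal (norm (f x))" for i
    proof (rule AE_I2)
      fix x
      have "norm (r i x) \<le> 2 * norm (f x)"
        by (simp add: r_def)
      then have "norm (f x - r i x) \<le> 3 * norm (f x)"
        using norm_triangle_ineq4[of "f x" "r i x"] by linarith
      then have "ennreal (norm (f x - r i x)) \<le> ennreal (3 * norm (f x))"
        by (rule ennreal_leI)
      then show "ennreal (norm (f x - r i x)) \<le> 3 * ennreal (norm (f x))"
        by (simp add: ennreal_mult)
    qed
    show "AE x in M. (\<lambda>i. ennreal (norm (f x - r i x))) \<longlonglongrightarrow> 0"
      using lim
    proof eventually_elim
      case (elim x)
      have "(\<lambda>i. r i x) \<longlonglongrightarrow> f x"
      \<comment> \<open>At a zero of \<open>f\<close> the cutoff forces \<open>r i x = 0\<close>.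
        Elsewhere the factor 2 leaves room above the norm of \<open>f x\<close>, so from some index
        on nothing is discarded.\<close>
      proof (cases "f x = 0")
        case True
        then have "r i x = 0" for i
          by (simp add: r_def)
        then show ?thesis
          using True by simp
      next
        case False
        then have "norm (f x) < 2 * norm (f x)"
          by simp
        then have "eventually (\<lambda>i. norm (s i x) < 2 * norm (f x)) sequentially"
          by (rule order_tendstoD(2)[OF tendsto_norm[OF elim]])
        then have "eventually (\<lambda>i. s i x = r i x) sequentially"
          by eventually_elim (simp add: r_def)
        then show ?thesis
          by (rule Lim_transform_eventually[OF elim])
      qed
      then have "(\<lambda>i. ennreal (norm (f x - r i x))) \<longlonglongrightarrow> ennreal (norm (f x - f x))"
        by (intro tendsto_intros)
      then show ?case by simp
    qed
    show "(\<integral>\<^sup>+x. 3 * ennreal (norm (f x)) \<partial>M) < \<infinity>"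
      using bound by (simp add: nn_integral_cmult ennreal_mult_less_top)
    show "(\<lambda>x. ennreal (norm (f x - r i x))) \<in> borel_measurable M" for i
      by (rule measurable_compose[OF r_meas measurable_ennreal])
  qed measurable
  then have d: "(\<lambda>i. \<integral>\<^sup>+x. ennreal (norm (f x - r i x)) \<partial>M) \<longlonglongrightarrow> 0"
    by simp
  have "Cauchy (\<lambda>i. Bochner_Integration.simple_bochner_integral M (r i))"
  proof (rule metric_CauchyI)
    fix e :: real assume e: "e > 0"
    then have "eventually (\<lambda>i. (\<integral>\<^sup>+x. ennreal (norm (f x - r i x)) \<partial>M) < ennreal (e / 2)) sequentially"
      using d by (intro order_tendstoD) auto
    then obtain N where N: "\<And>i. i \<ge> N \<Longrightarrow> (\<integral>\<^sup>+x. ennreal (norm (f x - r i x)) \<partial>M) < ennreal (e / 2)"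
      by (auto simp: eventually_sequentially)
    have "dist (Bochner_Integration.simple_bochner_integral M (r m)) (Bochner_Integration.simple_bochner_integral M (r n)) < e"
      if mn: "m \<ge> N" "n \<ge> N" for m n
    proof -
      \<comment> \<open>Both functions in the triangle inequality are \<open>f\<close>, so its
        middle term is 0.\<close>
      have "ennreal (norm (Bochner_Integration.simple_bochner_integral M (r m) - Bochner_Integration.simple_bochner_integral M (r n)))
          \<le> (\<integral>\<^sup>+x. ennreal (norm (f x - r m x)) \<partial>M) + (\<integral>\<^sup>+x. ennreal (norm (f x - r n x)) \<partial>M)"
        using simple_bochner_integral_diff_le[OF meas meas _ ri ri, of m n] by simp
      also have "\<dots> < ennreal (e / 2) + ennreal (e / 2)"
        using N[OF mn(1)] N[OF mn(2)] by (rule add_strict_mono)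
      also have "\<dots> = ennreal e"
        using e by (simp flip: ennreal_plus)
      finally show ?thesis
        using e by (simp add: dist_norm ennreal_less_iff)
    qed
    then show "\<exists>N. \<forall>m\<ge>N. \<forall>n\<ge>N. dist (Bochner_Integration.simple_bochner_integral M (r m))
        (Bochner_Integration.simple_bochner_integral M (r n)) < e"
      by blast
  qed
  then obtain y where "(\<lambda>i. Bochner_Integration.simple_bochner_integral M (r i)) \<longlonglongrightarrow> y"
    using Cauchy_convergent_iff convergentD by blast
  then show ?thesis
    unfolding has_bochner_def using meas ri d by (intro exI[of _ y] conjI exI[of _ r] allI)
qed

section \<open>Restriction to subintervals of time\<close>

lemma complete_measure_lebesgue_on:
  assumes "S \<in> sets lebesgue"
  shows "complete_measure (lebesgue_on S)"
proof
  fix A B assume "B \<subseteq> A" "A \<in> null_sets (lebesgue_on S)"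
  then have "A \<subseteq> S" "A \<in> null_sets lebesgue"
    using assms by (auto simp: null_sets_restrict_space)
  then have "B \<in> sets lebesgue" "B \<subseteq> S"
    using \<open>B \<subseteq> A\<close> completion.complete by blast+
  then show "B \<in> sets (lebesgue_on S)"
    using assms by (auto simp: sets_restrict_space_iff)
qed

lemma strongly_measurable_lebesgue_on_subset:
  assumes f: "strongly_measurable (lebesgue_on B) f"
    and AB: "A \<subseteq> B" "A \<in> sets lebesgue" "B \<in> sets lebesgue"
  shows "strongly_measurable (lebesgue_on A) f"
proof -
  obtain s where s: "\<And>i. simple_function (lebesgue_on B) (s i)"
    "AE x in lebesgue_on B. (\<lambda>i. s i x) \<longlonglongrightarrow> f x"
    using f unfolding strongly_measurable_def by blast
  show ?thesis
    unfolding strongly_measurable_def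
  proof (intro exI conjI allI)
    show "simple_function (lebesgue_on A) (s i)" for i
    proof -
      have "simple_function lebesgue (\<lambda>x. indicator B x *\<^sub>R s i x)"
        using s(1)[of i] AB by (simp add: simple_function_restrict_space)
      then have "simple_function lebesgue (\<lambda>x. indicator A x *\<^sub>R (indicator B x *\<^sub>R s i x))"
        by (rule simple_function_compose2[OF simple_function_indicator[OF AB(2)], where h = scaleR])
      also have "(\<lambda>x. indicator A x *\<^sub>R (indicator B x *\<^sub>R s i x)) = (\<lambda>x. indicator A x *\<^sub>R s i x)"
        using AB(1) by (auto simp: indicator_def fun_eq_iff)
      finally show ?thesis
        using AB by (simp add: simple_function_restrict_space)
    qed
    show "AE x in lebesgue_on A. (\<lambda>i. s i x) \<longlonglongrightarrow> f x"
      using s(2) AB by (auto simp: AE_restrict_space_iff)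
  qed
qed

lemma nn_integral_lebesgue_on_mono:
  assumes "A \<subseteq> B" "A \<in> sets lebesgue" "B \<in> sets lebesgue" "\<And>x. x \<in> A \<Longrightarrow> u x \<le> v x"
  shows "(\<integral>\<^sup>+x. u x \<partial>lebesgue_on A) \<le> (\<integral>\<^sup>+x. v x \<partial>lebesgue_on B)"
  using assms by (auto simp: nn_integral_restrict_space indicator_def intro!: nn_integral_mono)

text \<open>Freezing the time of the operators on a grid keeps the approximants simple.\<close>

lemma strongly_measurable_operator_family:
  fixes T :: "real \<Rightarrow> 'b::real_normed_vector \<Rightarrow> 'b"
  assumes f: "strongly_measurable (lebesgue_on {t..\<tau>}) f"
    and cont: "\<And>x. continuous_on {..\<tau>} (\<lambda>s. T s x)"
    and lip: "\<And>s x y. s \<le> \<tau> \<Longrightarrow> norm (T s x - T s y) \<le> norm (x - y)"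
  shows "strongly_measurable (lebesgue_on {t..\<tau>}) (\<lambda>s. T s (f s))"
proof -
  let ?M = "lebesgue_on {t..\<tau>}"
  obtain g where g: "\<And>i. simple_function ?M (g i)" "AE s in ?M. (\<lambda>i. g i s) \<longlonglongrightarrow> f s"
    using f unfolding strongly_measurable_def by blast
  \<comment> \<open>Times are rounded down, so that \<open>d n s\<close> never exceeds \<tau>, where
    contraction and continuity would be lost. It may fall below \<open>t\<close>, which is why both
    are assumed on the whole half-line up to \<tau>.\<close>
  define d where "d n s = of_int \<lfloor>real (Suc n) * s\<rfloor> / real (Suc n)" for n s
  have d_simple: "simple_function ?M (d n)" for n
  proof (rule simple_function_borel_measurable)
    have "(\<lambda>s. d n s) \<in> borel_measurable borel"
      unfolding d_def by measurable
    then show "d n \<in> borel_measurable ?M"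
      by (intro measurable_restrict_space1 measurable_completion) simp
    have "d n ` space ?M \<subseteq> (\<lambda>k. of_int k / real (Suc n)) ` {\<lfloor>real (Suc n) * t\<rfloor>..\<lfloor>real (Suc n) * \<tau>\<rfloor>}"
      by (auto simp: d_def simp del: of_nat_Suc intro!: imageI floor_mono mult_left_mono)
    then show "finite (d n ` space ?M)"
      by (rule finite_subset) simp
  qed
  have d_le: "d n s \<le> s" for n s
    using of_int_floor_le[of "real (Suc n) * s"] by (simp add: d_def pos_divide_le_eq mult.commute del: of_nat_Suc)
  have d_lim: "(\<lambda>n. d n s) \<longlonglongrightarrow> s" for s
  proof (rule tendsto_sandwich)
    have "(\<lambda>n. s - 1 / real (Suc n)) \<longlonglongrightarrow> s - 0"
      using LIMSEQ_Suc[OF lim_1_over_n] by (intro tendsto_diff tendsto_const)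
    then show "(\<lambda>n. s - 1 / real (Suc n)) \<longlonglongrightarrow> s"
      by simp
    have "s - 1 / real (Suc n) \<le> d n s" for n
    proof -
      have "real (Suc n) * s \<le> of_int \<lfloor>real (Suc n) * s\<rfloor> + 1"
        by linarith
      then have "s \<le> (of_int \<lfloor>real (Suc n) * s\<rfloor> + 1) / real (Suc n)"
        by (subst pos_le_divide_eq) (auto simp: mult.commute)
      then show ?thesis
        by (simp add: d_def add_divide_distrib)
    qed
    then show "eventually (\<lambda>n. s - 1 / real (Suc n) \<le> d n s) sequentially"
      by simp
    show "eventually (\<lambda>n. d n s \<le> s) sequentially"
      by (simp add: d_le)
  qed (rule tendsto_const)
  show ?thesis
    unfolding strongly_measurable_def
  proof (intro exI conjI allI)
    show "simple_function ?M (\<lambda>s. T (d n s) (g n s))" for n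
      by (rule simple_function_compose2[OF d_simple g(1), where h = T])
    show "AE s in ?M. (\<lambda>n. T (d n s) (g n s)) \<longlonglongrightarrow> T s (f s)"
      using g(2) AE_space
    proof eventually_elim
      case (elim s)
      then have s: "s \<le> \<tau>" by auto
      have d_le': "d n s \<le> \<tau>" for n
        using d_le[of n s] s by linarith
      then have lim1: "(\<lambda>n. T (d n s) (f s)) \<longlonglongrightarrow> T s (f s)"
        using s by (intro continuous_on_tendsto_compose[OF cont d_lim]) auto
      \<comment> \<open>The operator moves with \<open>n\<close> here; its Lipschitz constant,
        uniform in time, makes the convergence of \<open>g n s\<close> sufficient.\<close>
      have lim2: "(\<lambda>n. T (d n s) (g n s) - T (d n s) (f s)) \<longlonglongrightarrow> 0"
      proof (rule Lim_null_comparison)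
        show "eventually (\<lambda>n. norm (T (d n s) (g n s) - T (d n s) (f s)) \<le> norm (g n s - f s)) sequentially"
          by (intro always_eventually allI lip d_le')
        show "(\<lambda>n. norm (g n s - f s)) \<longlonglongrightarrow> 0"
          using elim(1) by (simp only: tendsto_norm_zero_iff LIM_zero_iff)
      qed
      from tendsto_add[OF lim2 lim1] show ?case
        by simp
    qed
  qed
qed

text \<open>The Bochner-style real integral in \<open>L1_norm\<close> would silently be 0 for a
  non-integrable integrand. Strong measurability of both functions and finiteness of their norms
  show that it is the true integral here, so the hypothesis on \<delta> has its intended
  content.\<close>

lemma L1_norm_diff:
  assumes "f \<in> L1 \<tau>" "g \<in> L1 \<tau>"
  shows "ennreal (L1_norm \<tau> (\<lambda>s. f s - g s)) = (\<integral>\<^sup>+s. norm (f s - g s) \<partial>lebesgue_on {0..\<tau>})"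
proof -
  let ?M = "lebesgue_on {0..\<tau>}"
  obtain y z where y: "has_bochner ?M f y" and z: "has_bochner ?M g z"
    using assms by (auto simp: L1_def)
  have complete: "complete_measure ?M"
    by (rule complete_measure_lebesgue_on) simp
  have norm_meas: "(\<lambda>s. norm (u s)) \<in> borel_measurable ?M" if "strongly_measurable ?M u" for u :: "real \<Rightarrow> 'a"
    by (rule measurable_compose[OF strongly_measurable_imp_borel_measurable[OF complete that]],
        rule borel_measurable_continuous_onI) (intro continuous_intros)
  note sm = y[THEN has_bochner_strongly_measurable] z[THEN has_bochner_strongly_measurable]
  note [measurable] = norm_meas[OF sm(1)] norm_meas[OF sm(2)] norm_meas[OF strongly_measurable_diff[OF sm]]
  have "(\<integral>\<^sup>+s. norm (f s - g s) \<partial>?M) \<le> (\<integral>\<^sup>+s. ennreal (norm (f s)) + ennreal (norm (g s)) \<partial>?M)"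
    by (intro nn_integral_mono) (simp add: norm_triangle_ineq4 flip: ennreal_plus)
  also have "\<dots> < \<infinity>"
    using has_bochner_nn_integral_finite[OF y] has_bochner_nn_integral_finite[OF z]
    by (simp add: nn_integral_add)
  finally have "integrable ?M (\<lambda>s. norm (f s - g s))"
    by (intro integrableI_bounded) auto
  then show ?thesis
    unfolding L1_norm_def by (subst nn_integral_eq_integral) auto
qed

text \<open>The contraction passes through the integral pointwise, and enlarging the interval from
  [t, \<tau>] to [0, \<tau>] only increases the bound. Stated for an abstract family, so that
  spectral theory enters only through the three properties of \<open>T\<close>.\<close>

lemma bochner_operator_family_diff_le:
  fixes T :: "real \<Rightarrow> 'b::banach \<Rightarrow> 'b"
  assumes f: "f \<in> L1 \<tau>" and g: "g \<in> L1 \<tau>" and t: "0 \<le> t"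
    and cont: "\<And>x. continuous_on {..\<tau>} (\<lambda>s. T s x)"
    and lip: "\<And>s x y. s \<le> \<tau> \<Longrightarrow> norm (T s x - T s y) \<le> norm (x - y)"
    and zero: "\<And>s. s \<le> \<tau> \<Longrightarrow> T s 0 = 0"
  shows "norm (bochner (lebesgue_on {t..\<tau>}) (\<lambda>s. T s (f s)) - bochner (lebesgue_on {t..\<tau>}) (\<lambda>s. T s (g s)))
    \<le> L1_norm \<tau> (\<lambda>s. f s - g s)"
proof -
  let ?M = "lebesgue_on {t..\<tau>}"
  have complete: "complete_measure ?M"
    by (rule complete_measure_lebesgue_on) simp
  have fin: "finite_measure ?M"
    by (intro finite_measureI) (cases "t \<le> \<tau>"; simp add: emeasure_restrict_space)
  have sub: "{t..\<tau>} \<subseteq> {0..\<tau>}"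
    using t by auto
  \<comment> \<open>Existence must be settled before the estimate: without it,
    \<open>bochner\<close> would be an unspecified \<open>THE\<close> value.\<close>
  have ex: "strongly_measurable ?M (\<lambda>s. T s (u s)) \<and> (\<exists>y. has_bochner ?M (\<lambda>s. T s (u s)) y)" if u: "u \<in> L1 \<tau>" for u
  proof -
    obtain z where z: "has_bochner (lebesgue_on {0..\<tau>}) u z"
      using u by (auto simp: L1_def)
    have "strongly_measurable ?M u"
      by (rule strongly_measurable_lebesgue_on_subset[OF has_bochner_strongly_measurable[OF z] sub]) auto
    then have sm: "strongly_measurable ?M (\<lambda>s. T s (u s))"
      by (rule strongly_measurable_operator_family[OF _ cont lip])
    have "(\<integral>\<^sup>+s. norm (T s (u s)) \<partial>?M) \<le> (\<integral>\<^sup>+s. norm (u s) \<partial>lebesgue_on {0..\<tau>})"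
    proof (rule nn_integral_lebesgue_on_mono[OF sub])
      show "ennreal (norm (T s (u s))) \<le> ennreal (norm (u s))" if "s \<in> {t..\<tau>}" for s
        using lip[of s "u s" 0] zero[of s] that by (auto intro: ennreal_leI)
    qed auto
    then have "(\<integral>\<^sup>+s. norm (T s (u s)) \<partial>?M) < \<infinity>"
      using has_bochner_nn_integral_finite[OF z] by (rule le_less_trans)
    then show ?thesis
      using sm strongly_measurable_has_bochner[OF complete fin sm] by blast
  qed
  obtain y z where y: "has_bochner ?M (\<lambda>s. T s (f s)) y" and z: "has_bochner ?M (\<lambda>s. T s (g s)) z"
    using ex[OF f] ex[OF g] by blast
  have "(\<lambda>s. norm (T s (f s) - T s (g s))) \<in> borel_measurable ?M"
    using ex[OF f] ex[OF g]
    by (intro measurable_compose[OF strongly_measurable_imp_borel_measurable[OF complete strongly_measurable_diff]]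
        borel_measurable_continuous_onI continuous_intros) auto
  then have "ennreal (norm (y - z)) \<le> (\<integral>\<^sup>+s. norm (T s (f s) - T s (g s)) \<partial>?M)"
    by (rule has_bochner_diff_le[OF y z])
  also have "\<dots> \<le> (\<integral>\<^sup>+s. norm (f s - g s) \<partial>lebesgue_on {0..\<tau>})"
    by (rule nn_integral_lebesgue_on_mono[OF sub]) (auto intro!: ennreal_leI lip)
  also have "\<dots> = ennreal (L1_norm \<tau> (\<lambda>s. f s - g s))"
    by (rule L1_norm_diff[OF f g, symmetric])
  finally show ?thesis
    by (simp add: bochner_eqI[OF y] bochner_eqI[OF z] L1_norm_def)
qed

section \<open>Stability and convergence of the truncated solutions\<close>

lemma norm_psi_diff_le:
  fixes E :: "real \<Rightarrow> 'h::{real_inner, banach} \<Rightarrow> 'h"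
  assumes E: "spectral_family E" and "f \<in> L1 \<tau>" "f' \<in> L1 \<tau>" "0 \<le> t"
  shows "norm (psi E \<tau> \<phi> f t - psi E \<tau> \<phi>' f' t) \<le> norm (\<phi> - \<phi>') + L1_norm \<tau> (\<lambda>s. f s - f' s)"
proof -
  let ?T = "\<lambda>s. fun_op E (\<lambda>l. exp (- (\<tau> - s) * l))"
  let ?I = "\<lambda>f. bochner (lebesgue_on {t..\<tau>}) (\<lambda>s. ?T s (f s))"
  have "norm (?I f - ?I f') \<le> L1_norm \<tau> (\<lambda>s. f s - f' s)"
  proof (rule bochner_operator_family_diff_le[OF assms(2-4)])
    show "continuous_on {..\<tau>} (\<lambda>s. ?T s x)" for x
      by (rule fun_op_exp_continuous[OF E])
    show "norm (?T s x - ?T s y) \<le> norm (x - y)" if "s \<le> \<tau>" for s x y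
      by (rule fun_op_exp_contraction[OF E]) (use that in simp)
    show "?T s 0 = 0" if "s \<le> \<tau>" for s
      by (rule fun_op_exp_zero[OF E]) (use that in simp)
  qed
  then have "norm ((\<phi> - \<phi>') - (?I f - ?I f')) \<le> norm (\<phi> - \<phi>') + L1_norm \<tau> (\<lambda>s. f s - f' s)"
    by (rule order_trans[OF norm_triangle_ineq4 add_left_mono])
  moreover have "psi E \<tau> \<phi> f t - psi E \<tau> \<phi>' f' t = (\<phi> - \<phi>') - (?I f - ?I f')"
    by (simp add: psi_def)
  ultimately show ?thesis
    by (simp only:)
qed

lemma truncated_solution_stable:
  fixes E :: "real \<Rightarrow> 'h::{real_inner, banach} \<Rightarrow> 'h"
  assumes E: "spectral_family E" and "f \<in> L1 \<tau>" "f' \<in> L1 \<tau>"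
    and \<delta>: "norm (\<phi> - \<phi>') + L1_norm \<tau> (\<lambda>s. f s - f' s) \<le> \<delta>"
    and "t \<in> {0..\<tau>}" "\<beta> > 0"
  shows "norm (truncated_solution E \<tau> \<phi> f \<beta> t - truncated_solution E \<tau> \<phi>' f' \<beta> t)
    \<le> exp ((\<tau> - t) * \<beta>) * \<delta>"
proof -
  have "norm (truncated_solution E \<tau> \<phi> f \<beta> t - truncated_solution E \<tau> \<phi>' f' \<beta> t)
      \<le> exp ((\<tau> - t) * \<beta>) * norm (psi E \<tau> \<phi> f t - psi E \<tau> \<phi>' f' t)"
    unfolding truncated_solution_def
    by (rule truncated_exp_lipschitz[OF E]) (use assms in auto)
  also have "\<dots> \<le> exp ((\<tau> - t) * \<beta>) * \<delta>"
    using norm_psi_diff_le[OF E assms(2,3), of t \<phi> \<phi>'] assms(5) \<delta> by (intro mult_left_mono) auto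
  finally show ?thesis .
qed

lemma truncated_solution_error:
  fixes E :: "real \<Rightarrow> 'h::{real_inner, banach} \<Rightarrow> 'h"
  assumes E: "spectral_family E" and t: "t \<in> {0..<\<tau>}"
    and psi: "psi E \<tau> \<phi> f t \<in> fun_dom E (\<lambda>l. exp (\<tau> * l))"
    and h: "continuous_on {0..} h" "mono_on {0..} h" "\<And>l. l \<ge> 0 \<Longrightarrow> h l > 0"
    and u: "mild_solution E \<tau> \<phi> f t \<in> fun_dom E h"
    and \<beta>: "\<beta> > 0"
  defines "w \<equiv> fun_op E h (mild_solution E \<tau> \<phi> f t)"
  shows "norm (mild_solution E \<tau> \<phi> f t - truncated_solution E \<tau> \<phi> f \<beta> t) \<le> norm (w - E \<beta> w) / h \<beta>"
proof -
  \<comment> \<open>Since t \<ge> 0, the assumed domain of the exponential with rate \<tau> lies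
    inside the one with rate \<tau> - t that occurs in the mild solution.\<close>
  have "psi E \<tau> \<phi> f t \<in> fun_dom E (\<lambda>l. exp ((\<tau> - t) * l))"
    by (rule fun_dom_exp_mono[OF E _ psi]) (use t in simp)
  then have "truncated_solution E \<tau> \<phi> f \<beta> t = E \<beta> (mild_solution E \<tau> \<phi> f t)"
    using t by (simp add: truncated_solution_def mild_solution_def truncated_exp_eq[OF E])
  then show ?thesis
    using spectral_tail_bound[OF E h u less_imp_le[OF \<beta>]] by (simp add: w_def)
qed

theorem theorem9:
  fixes D :: "'h::{real_inner, banach} set"
    and A :: "'h \<Rightarrow> 'h"
    and E :: "real \<Rightarrow> 'h \<Rightarrow> 'h"
    and \<tau> :: real
    and \<phi> :: 'h
    and f :: "real \<Rightarrow> 'h"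
  assumes "self_adjoint_operator D A"
    and "positive_operator D A"
    and "spectral_resolution D A E"
    and "\<tau> > 0"
    and "f \<in> L1 \<tau>"
  shows
    "(\<forall>\<phi>' f' \<delta>.
        f' \<in> L1 \<tau> \<and> \<delta> > 0 \<and> norm (\<phi> - \<phi>') + L1_norm \<tau> (\<lambda>s. f s - f' s) \<le> \<delta> \<longrightarrow>
        (\<forall>t\<in>{0..\<tau>}. \<forall>\<beta>>0.
           norm (truncated_solution E \<tau> \<phi> f \<beta> t - truncated_solution E \<tau> \<phi>' f' \<beta> t)
             \<le> exp ((\<tau> - t) * \<beta>) * \<delta>))
     \<and>
     (\<forall>t h \<rho>.
        (\<forall>s\<in>{0..<\<tau>}. psi E \<tau> \<phi> f s \<in> fun_dom E (\<lambda>l. exp (\<tau> * l))) \<and>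
        t \<in> {0..<\<tau>} \<and>
        continuous_on {0..} h \<and> mono_on {0..} h \<and> (\<forall>l\<ge>0. h l > 0) \<and>
        filterlim h at_top at_top \<and>
        mild_solution E \<tau> \<phi> f t \<in> fun_dom E h \<and>
        \<rho> > 0 \<and> norm (fun_op E h (mild_solution E \<tau> \<phi> f t)) \<le> \<rho> \<longrightarrow>
        (\<exists>r :: real \<Rightarrow> real.
           (\<forall>\<beta>>0. 0 \<le> r \<beta> \<and> r \<beta> \<le> \<rho>) \<and>
           (r \<longlongrightarrow> 0) at_top \<and>
           (\<forall>\<beta>>0. norm (mild_solution E \<tau> \<phi> f t - truncated_solution E \<tau> \<phi> f \<beta> t)
                      \<le> r \<beta> / h \<beta>) \<and>
           (\<forall>\<phi>' f' \<delta>.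
              f' \<in> L1 \<tau> \<and> \<delta> > 0 \<and> norm (\<phi> - \<phi>') + L1_norm \<tau> (\<lambda>s. f s - f' s) \<le> \<delta> \<longrightarrow>
              (\<forall>\<beta>>0. norm (mild_solution E \<tau> \<phi> f t - truncated_solution E \<tau> \<phi>' f' \<beta> t)
                         \<le> r \<beta> / h \<beta> + exp ((\<tau> - t) * \<beta>) * \<delta>))))"
proof -
  have E: "spectral_family E"
    using assms(3) by (simp add: spectral_resolution_def)
  have stable: "norm (truncated_solution E \<tau> \<phi> f \<beta> t - truncated_solution E \<tau> \<phi>' f' \<beta> t)
      \<le> exp ((\<tau> - t) * \<beta>) * \<delta>"
    if "f' \<in> L1 \<tau> \<and> \<delta> > 0 \<and> norm (\<phi> - \<phi>') + L1_norm \<tau> (\<lambda>s. f s - f' s) \<le> \<delta>" "t \<in> {0..\<tau>}" "\<beta> > 0"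
    for \<phi>' f' \<delta> t \<beta>
    using truncated_solution_stable[OF E assms(5)] that by blast
  show ?thesis
  proof (intro conjI allI impI ballI)
    fix t h \<rho>
    assume H: "(\<forall>s\<in>{0..<\<tau>}. psi E \<tau> \<phi> f s \<in> fun_dom E (\<lambda>l. exp (\<tau> * l))) \<and>
        t \<in> {0..<\<tau>} \<and>
        continuous_on {0..} h \<and> mono_on {0..} h \<and> (\<forall>l\<ge>0. h l > 0) \<and>
        filterlim h at_top at_top \<and>
        mild_solution E \<tau> \<phi> f t \<in> fun_dom E h \<and>
        \<rho> > 0 \<and> norm (fun_op E h (mild_solution E \<tau> \<phi> f t)) \<le> \<rho>"
    define w where "w = fun_op E h (mild_solution E \<tau> \<phi> f t)"
    \<comment> \<open>Built from \<open>w\<close> alone, before any perturbed data are introduced,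
      hence independent of them and of \<delta>. It is at most the norm of \<open>w\<close> by
      Pythagoras and tends to 0 because the projections tend strongly to the identity.\<close>
    define r where "r \<beta> = norm (w - E \<beta> w)" for \<beta>
    have error: "norm (mild_solution E \<tau> \<phi> f t - truncated_solution E \<tau> \<phi> f \<beta> t) \<le> r \<beta> / h \<beta>"
      if "\<beta> > 0" for \<beta>
      unfolding r_def w_def using H that by (intro truncated_solution_error[OF E]) auto
    have "(r \<beta>)\<^sup>2 \<le> (norm w)\<^sup>2" for \<beta>
      by (simp add: r_def spectral_projection_pythagoras[OF E])
    then have "r \<beta> \<le> norm w" for \<beta>
      by (rule power2_le_imp_le) simp
    then have bound: "0 \<le> r \<beta> \<and> r \<beta> \<le> \<rho>" for \<beta>
      using H order_trans by (fastforce simp: r_def w_def)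
    have "(r \<longlongrightarrow> norm (w - w)) at_top"
      unfolding r_def by (intro tendsto_intros spectral_projection_tendsto_at_top[OF E])
    then have lim: "(r \<longlongrightarrow> 0) at_top"
      by simp
    show "\<exists>r :: real \<Rightarrow> real.
           (\<forall>\<beta>>0. 0 \<le> r \<beta> \<and> r \<beta> \<le> \<rho>) \<and>
           (r \<longlongrightarrow> 0) at_top \<and>
           (\<forall>\<beta>>0. norm (mild_solution E \<tau> \<phi> f t - truncated_solution E \<tau> \<phi> f \<beta> t)
                      \<le> r \<beta> / h \<beta>) \<and>
           (\<forall>\<phi>' f' \<delta>.
              f' \<in> L1 \<tau> \<and> \<delta> > 0 \<and> norm (\<phi> - \<phi>') + L1_norm \<tau> (\<lambda>s. f s - f' s) \<le> \<delta> \<longrightarrow>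
              (\<forall>\<beta>>0. norm (mild_solution E \<tau> \<phi> f t - truncated_solution E \<tau> \<phi>' f' \<beta> t)
                         \<le> r \<beta> / h \<beta> + exp ((\<tau> - t) * \<beta>) * \<delta>))"
    proof (intro exI[of _ r] conjI allI impI)
      fix \<phi>' f' \<delta> and \<beta> :: real
      assume data: "f' \<in> L1 \<tau> \<and> \<delta> > 0 \<and> norm (\<phi> - \<phi>') + L1_norm \<tau> (\<lambda>s. f s - f' s) \<le> \<delta>"
        and \<beta>: "\<beta> > 0"
      have "t \<in> {0..\<tau>}"
        using H by auto
      from norm_triangle_le[OF add_mono[OF error[OF \<beta>] stable[OF data this \<beta>]]]
      show "norm (mild_solution E \<tau> \<phi> f t - truncated_solution E \<tau> \<phi>' f' \<beta> t)
          \<le> r \<beta> / h \<beta> + exp ((\<tau> - t) * \<beta>) * \<delta>"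
        by simp
    qed (use bound lim error in auto)
  qed (use stable in blast)
qed

end
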